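(* Let $G_1, G_2, G_3$ be (possibly empty) complete multipartite graphs such that every partite set of $G_2$ has even size and every partite set of $G_3$ has size divisible by $4$, and let $q_1,q_2,q_3\ge 0$ be integers. Let $\gamma$ be the complete multipartite graph $4G_1+2G_2+G_3+K_{q_1,q_2,q_3}$. Suppose that one of the following conditions holds: (1) two or three of the $q_i$ equal $0$; (2) two of the $q_i$ are odd and equal, and the third $q_i=0$; (3) two of the $q_i$ are odd and equal, the third $q_i\equiv 1 \pmod 4$, and $G_1=\emptyset$; (4) one $q_i\equiv 2\pmod 4$, one $q_i\equiv 1 \pmod 4$, and the third $q_i=0$; (5) two of the $q_i$ satisfy $q_i\equiv 2\pmod 4$, the third $q_i=0$, and $G_1=\emptyset$. Then $\gamma$ is achirally embeddable in $S^3$.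
   Context: A graph is achirally embeddable in $S^3$ if it has an embedding $\Gamma$ in $S^3$ for which there is an orientation-reversing homeomorphism $h$ of $S^3$ with $h(\Gamma)=\Gamma$ (equivalently, $\Gamma$ is ambient isotopic to its mirror image). The join $A+B$ of graphs $A$ and $B$ is the disjoint union $A\cup B$ together with edges joining every vertex of $A$ to every vertex of $B$; for a natural number $n$ and a graph $G$, $nG$ denotes the join of $n$ copies of $G$. In a complete multipartite graph $K_{m_1,\dots,m_n}$ the partite sets are the $n$ independent sets of vertices, and the size of a partite set is its number of vertices. A partite set of size $0$ (e.g. $q_i=0$) simply means that partite set is absent, and an empty graph contributes nothing to a join. *)

theory Defs
  imports "HOL-Homology.Homology" "HOL-Library.Multiset"
begin

text \<open>S^3 is the topological space nsphere 3 (unit sphere in the first four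
  coordinates of nat => real).  A finite graph is given by a vertex set V and a set E
  of edges, each edge being a 2-element subset of V.\<close>

definition graph_embedding ::
  "'v set \<Rightarrow> 'v set set \<Rightarrow> ('v \<Rightarrow> nat \<Rightarrow> real) \<Rightarrow> ('v set \<Rightarrow> real \<Rightarrow> nat \<Rightarrow> real) \<Rightarrow> bool" where
  "graph_embedding V E \<phi> \<alpha> \<longleftrightarrow>
     inj_on \<phi> V \<and> \<phi> ` V \<subseteq> topspace (nsphere 3) \<and>
     (\<forall>e\<in>E. continuous_map (top_of_set {0..1}) (nsphere 3) (\<alpha> e) \<and>
             inj_on (\<alpha> e) {0..1} \<and> {\<alpha> e 0, \<alpha> e 1} = \<phi> ` e) \<and>
     (\<forall>e\<in>E. \<forall>t\<in>{0<..<1}. \<alpha> e t \<notin> \<phi> ` V) \<and>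
     (\<forall>e\<in>E. \<forall>e'\<in>E. e \<noteq> e' \<longrightarrow> \<alpha> e ` {0<..<1} \<inter> \<alpha> e' ` {0..1} = {})"

definition spatial_graph ::
  "'v set \<Rightarrow> 'v set set \<Rightarrow> ('v \<Rightarrow> nat \<Rightarrow> real) \<Rightarrow> ('v set \<Rightarrow> real \<Rightarrow> nat \<Rightarrow> real) \<Rightarrow> (nat \<Rightarrow> real) set" where
  "spatial_graph V E \<phi> \<alpha> = \<phi> ` V \<union> (\<Union>e\<in>E. \<alpha> e ` {0..1})"

definition orientation_reversing_homeo_S3 :: "((nat \<Rightarrow> real) \<Rightarrow> nat \<Rightarrow> real) \<Rightarrow> bool" where
  "orientation_reversing_homeo_S3 h \<longleftrightarrow>
     homeomorphic_map (nsphere 3) (nsphere 3) h \<and> Brouwer_degree2 3 h = -1"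

definition achirally_embeddable :: "'v set \<Rightarrow> 'v set set \<Rightarrow> bool" where
  "achirally_embeddable V E \<longleftrightarrow>
     (\<exists>\<phi> \<alpha> h. graph_embedding V E \<phi> \<alpha> \<and> orientation_reversing_homeo_S3 h \<and>
        h ` spatial_graph V E \<phi> \<alpha> = spatial_graph V E \<phi> \<alpha>)"

text \<open>The complete multipartite graph whose partite sets have sizes given by the list ms
  (a size 0 entry is an absent partite set). Vertex (i,j) is the j-th vertex of the
  i-th partite set.\<close>
definition cmp_vertices :: "nat list \<Rightarrow> (nat \<times> nat) set" where
  "cmp_vertices ms = {(i, j). i < length ms \<and> j < ms ! i}"

definition cmp_edges :: "nat list \<Rightarrow> (nat \<times> nat) set set" where
  "cmp_edges ms = {{u, v} | u v. u \<in> cmp_vertices ms \<and> v \<in> cmp_vertices ms \<and> fst u \<noteq> fst v}"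

text \<open>Partite-set list of the join n G of n copies of the complete multipartite graph G
  (the join of complete multipartite graphs is complete multipartite, with the union of
  the partite sets).\<close>
definition join_copies :: "nat \<Rightarrow> nat list \<Rightarrow> nat list" where
  "join_copies n ms = concat (replicate n ms)"

end

theory Submission
  imports Defs "HOL-Combinatorics.List_Permutation"
begin

text \<open>
  Work with the rotoreflection \<open>h (\<xi>, \<zeta>) = (\<i> * \<xi>, cnj \<zeta>)\<close> of the unit sphere of \<open>\<complex>\<^sup>2\<close>.  It has order four
  and reverses orientation; it acts freely on the circle \<open>\<zeta> = 0\<close> and reflects the circle \<open>\<xi> = 0\<close>,
  the axis, which is the fixed set of \<open>h \<circ> h\<close>.  Up to at most four vertices, the vertices of the
  graph can be grouped into orbits of a graph automorphism on which it acts as a 4-cycle, and these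
  are placed on the first circle.  That circle is the binding of an open book whose pages are
  indexed by the points of the axis, and \<open>h\<close> maps the page at \<open>z\<close> to the page at \<open>cnj z\<close>.  Every orbit of
  edges under \<open>h \<circ> h\<close> is drawn as one or two disjoint chords in a page of its own.  The exceptional
  vertices sit on the axis: edges from them to the binding are radii in their pages, and edges
  between them are arcs of the axis.  Only chords between opposite points of the binding meet the
  axis; they come from the copies of \<open>G\<^sub>1\<close>, and they fit if some arc of the axis is left free.
\<close>

section \<open>The rotoreflection of the 3-sphere\<close>

text \<open>The coordinates are ordered so that conjugating the second component changes the sign of
  coordinate 0, the reflection whose degree \<open>Brouwer_degree2_reflection\<close>
  computes.\<close>

definition S3_point :: "complex \<times> complex \<Rightarrow> nat \<Rightarrow> real" where
  "S3_point p i = (if i = 0 then Im (snd p) else if i = 1 then Re (snd p)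
     else if i = 2 then Re (fst p) else if i = 3 then Im (fst p) else 0)"

text \<open>In the coordinates of \<open>S3_point\<close> this is multiplication of the first
  component by \<open>c + s * \<i>\<close>.\<close>

definition rotate23 :: "real \<Rightarrow> real \<Rightarrow> (nat \<Rightarrow> real) \<Rightarrow> nat \<Rightarrow> real" where
  "rotate23 c s x i = (if i = 2 then c * x 2 - s * x 3 else if i = 3 then s * x 2 + c * x 3 else x i)"

definition reflect0 :: "(nat \<Rightarrow> real) \<Rightarrow> nat \<Rightarrow> real" where
  "reflect0 = (\<lambda>x i. if i = 0 then - x i else x i)"

definition rotoreflection :: "complex \<times> complex \<Rightarrow> complex \<times> complex" where
  "rotoreflection p = (\<i> * fst p, cnj (snd p))"

lemma topspace_nsphere_3:
  "topspace (nsphere 3) = {x. (x 0)\<^sup>2 + (x 1)\<^sup>2 + (x 2)\<^sup>2 + (x 3)\<^sup>2 = 1 \<and> (\<forall>i>3. x i = 0)}"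
  by (auto simp: nsphere eval_nat_numeral)

lemma S3_point_in_sphere: "norm p = 1 \<Longrightarrow> S3_point p \<in> topspace (nsphere 3)"
  by (cases p)
    (auto simp: topspace_nsphere_3 S3_point_def norm_prod_def cmod_def real_sqrt_eq_1_iff algebra_simps)

lemma inj_S3_point: "inj S3_point"
proof (rule injI)
  fix p q assume "S3_point p = S3_point q"
  then have "S3_point p i = S3_point q i" for i
    by simp
  from this[of 0] this[of 1] this[of 2] this[of 3] show "p = q"
    by (auto simp: S3_point_def prod_eq_iff complex_eq_iff)
qed

lemma continuous_map_S3_point:
  assumes "continuous_on S f" "\<And>t. t \<in> S \<Longrightarrow> norm (f t) = 1"
  shows "continuous_map (top_of_set S) (nsphere 3) (\<lambda>t. S3_point (f t))"
proof -
  have "continuous_map (top_of_set S) (powertop_real UNIV) (\<lambda>t. S3_point (f t))"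
    unfolding continuous_map_componentwise_UNIV
  proof
    fix i :: nat
    consider "i = 0" | "i = 1" | "i = 2" | "i = 3" | "i > 3" by linarith
    then show "continuous_map (top_of_set S) euclideanreal (\<lambda>t. S3_point (f t) i)"
      by cases (simp_all add: S3_point_def assms(1) continuous_intros)
  qed
  moreover have "(\<lambda>t. S3_point (f t)) \<in> topspace (top_of_set S) \<rightarrow> topspace (nsphere 3)"
    using S3_point_in_sphere assms(2) by auto
  ultimately show ?thesis
    by (simp add: nsphere continuous_map_in_subtopology image_subset_iff Pi_iff)
qed

lemma continuous_map_rotate23:
  assumes "c\<^sup>2 + s\<^sup>2 = 1"
  shows "continuous_map (nsphere 3) (nsphere 3) (rotate23 c s)"
proof -
  have "continuous_map (nsphere 3) euclideanreal (\<lambda>x. rotate23 c s x i)" for i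
    unfolding rotate23_def
    by (auto intro!: continuous_intros continuous_map_nsphere_projection)
  then have "continuous_map (nsphere 3) (powertop_real UNIV) (rotate23 c s)"
    by (simp add: continuous_map_componentwise_UNIV)
  moreover have "rotate23 c s x \<in> topspace (nsphere 3)" if "x \<in> topspace (nsphere 3)" for x
  proof -
    have "(c * x 2 - s * x 3)\<^sup>2 + (s * x 2 + c * x 3)\<^sup>2 = (c\<^sup>2 + s\<^sup>2) * ((x 2)\<^sup>2 + (x 3)\<^sup>2)"
      by (simp add: power2_eq_square algebra_simps)
    with assms that show ?thesis
      by (auto simp: topspace_nsphere_3 rotate23_def)
  qed
  ultimately show ?thesis
    unfolding nsphere by (auto simp: continuous_map_in_subtopology)
qed

lemma rotate23_rotate23:
  "rotate23 c s \<circ> rotate23 c' s' = rotate23 (c * c' - s * s') (s * c' + c * s')"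
  by (auto simp: rotate23_def fun_eq_iff algebra_simps)

lemma rotate23_id: "rotate23 1 0 = id"
  by (auto simp: rotate23_def fun_eq_iff)

lemma homeomorphic_map_rotate23:
  assumes "c\<^sup>2 + s\<^sup>2 = 1"
  shows "homeomorphic_map (nsphere 3) (nsphere 3) (rotate23 c s)"
proof -
  have "rotate23 c s \<circ> rotate23 c (- s) = id" "rotate23 c (- s) \<circ> rotate23 c s = id"
    using assms by (simp_all add: rotate23_rotate23 power2_eq_square rotate23_id algebra_simps)
  then have "homeomorphic_maps (nsphere 3) (nsphere 3) (rotate23 c s) (rotate23 c (- s))"
    using assms
    by (simp add: homeomorphic_maps_def continuous_map_rotate23 pointfree_idE)
  then show ?thesis
    using homeomorphic_map_maps by blast
qed

text \<open>A quarter turn is the square of an eighth turn, and the degree of the latter is \<open>\<plusminus> 1\<close>.\<close>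

lemma Brouwer_degree2_quarter_turn: "Brouwer_degree2 3 (rotate23 0 1) = 1"
proof -
  let ?r = "rotate23 (1 / sqrt 2) (1 / sqrt 2)"
  have sq: "(1 / sqrt 2)\<^sup>2 + (1 / sqrt 2)\<^sup>2 = (1::real)"
    by (simp add: power_divide)
  have "rotate23 0 1 = ?r \<circ> ?r"
    unfolding rotate23_rotate23 by simp
  then have "Brouwer_degree2 3 (rotate23 0 1) = Brouwer_degree2 3 ?r * Brouwer_degree2 3 ?r"
    by (simp add: Brouwer_degree2_compose continuous_map_rotate23 sq)
  moreover have "\<bar>Brouwer_degree2 3 ?r\<bar> = 1"
    using Brouwer_degree2_homeomorphic_map homeomorphic_map_rotate23 sq by blast
  ultimately show ?thesis
    by (metis abs_mult_self_eq mult_1)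
qed

text \<open>Degrees multiply under composition: 1 for the quarter turn and -1 for the
  reflection.\<close>

lemma orientation_reversing_rotoreflection:
  "orientation_reversing_homeo_S3 (rotate23 0 1 \<circ> reflect0)"
proof -
  have cont: "continuous_map (nsphere 3) (nsphere 3) reflect0"
    unfolding reflect0_def by (rule continuous_map_nsphere_reflection)
  have "reflect0 \<circ> reflect0 = id"
    by (auto simp: reflect0_def fun_eq_iff)
  then have "homeomorphic_maps (nsphere 3) (nsphere 3) reflect0 reflect0"
    using cont by (simp add: homeomorphic_maps_def pointfree_idE)
  then have homeo: "homeomorphic_map (nsphere 3) (nsphere 3) reflect0"
    using homeomorphic_map_maps by blast
  have "Brouwer_degree2 3 reflect0 = -1"
    unfolding reflect0_def by (rule Brouwer_degree2_reflection)
  then have "Brouwer_degree2 3 (rotate23 0 1 \<circ> reflect0) = -1"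
    by (simp add: Brouwer_degree2_compose cont continuous_map_rotate23 Brouwer_degree2_quarter_turn)
  moreover have "homeomorphic_map (nsphere 3) (nsphere 3) (rotate23 0 1 \<circ> reflect0)"
    by (rule homeomorphic_map_compose[OF homeo homeomorphic_map_rotate23]) simp
  ultimately show ?thesis
    by (simp add: orientation_reversing_homeo_S3_def)
qed

lemma S3_point_rotoreflection:
  "(rotate23 0 1 \<circ> reflect0) (S3_point p) = S3_point (rotoreflection p)"
  by (auto simp: fun_eq_iff rotate23_def reflect0_def S3_point_def rotoreflection_def)

text \<open>This moves the whole problem to complex coordinates. One inclusion suffices for
  invariance because the map has order four, so its third iterate is its inverse. Contact of an open
  edge with an end of another edge is a case of \<open>vertex\<close>.\<close>

lemma achirally_embeddableI:
  fixes V :: "'v set" and E :: "'v set set" and pos :: "'v \<Rightarrow> complex \<times> complex"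
    and path :: "'v set \<Rightarrow> real \<Rightarrow> complex \<times> complex"
  defines "\<Gamma> \<equiv> pos ` V \<union> (\<Union>e\<in>E. path e ` {0..1})"
  assumes inj: "inj_on pos V"
    and pos: "\<And>v. v \<in> V \<Longrightarrow> norm (pos v) = 1"
    and cont: "\<And>e. e \<in> E \<Longrightarrow> continuous_on {0..1} (path e)"
    and path: "\<And>e t. e \<in> E \<Longrightarrow> t \<in> {0..1} \<Longrightarrow> norm (path e t) = 1"
    and inj_path: "\<And>e. e \<in> E \<Longrightarrow> inj_on (path e) {0..1}"
    and ends: "\<And>e. e \<in> E \<Longrightarrow> {path e 0, path e 1} = pos ` e"
    and vertex: "\<And>e t v. e \<in> E \<Longrightarrow> t \<in> {0<..<1} \<Longrightarrow> v \<in> V \<Longrightarrow> path e t \<noteq> pos v"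
    and interior: "\<And>e e' t t'. e \<in> E \<Longrightarrow> e' \<in> E \<Longrightarrow> t \<in> {0<..<1} \<Longrightarrow> t' \<in> {0<..<1}
      \<Longrightarrow> path e t = path e' t' \<Longrightarrow> e = e'"
    and edges: "\<And>e. e \<in> E \<Longrightarrow> e \<subseteq> V"
    and invariant: "rotoreflection ` \<Gamma> \<subseteq> \<Gamma>"
  shows "achirally_embeddable V E"
proof -
  define \<phi> where "\<phi> = S3_point \<circ> pos"
  define \<alpha> where "\<alpha> = (\<lambda>e t. S3_point (path e t))"
  let ?h = "rotate23 0 1 \<circ> reflect0"
  have disj: "path e t \<noteq> path e' t'"
    if e: "e \<in> E" "t \<in> {0<..<1}" and e': "e' \<in> E" "t' \<in> {0..1}" and "e \<noteq> e'" for e e' t t'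
  proof (cases "t' \<in> {0<..<1}")
    case True
    then show ?thesis using interior e e' \<open>e \<noteq> e'\<close> by blast
  next
    case False
    then have "t' = 0 \<or> t' = 1" using e' by auto
    then have "path e' t' \<in> pos ` e'" using ends[OF e'(1)] by auto
    then obtain v where "v \<in> V" "path e' t' = pos v"
      using edges[OF e'(1)] by blast
    then show ?thesis using vertex[OF e] by simp
  qed
  have eq: "S3_point p = S3_point q \<longleftrightarrow> p = q" for p q
    using inj_S3_point by (auto dest: injD)
  have "graph_embedding V E \<phi> \<alpha>"
    unfolding graph_embedding_def
  proof (intro conjI ballI impI)
    show "inj_on \<phi> V"
      unfolding \<phi>_def using inj inj_S3_point by (meson comp_inj_on inj_on_subset top_greatest)
    show "\<phi> ` V \<subseteq> topspace (nsphere 3)"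
      unfolding \<phi>_def using S3_point_in_sphere[OF pos] by auto
  next
    fix e assume e: "e \<in> E"
    show "continuous_map (top_of_set {0..1}) (nsphere 3) (\<alpha> e)"
      unfolding \<alpha>_def by (rule continuous_map_S3_point[OF cont[OF e] path[OF e]])
    show "inj_on (\<alpha> e) {0..1}"
      using inj_path[OF e] by (simp add: \<alpha>_def inj_on_def eq)
    show "{\<alpha> e 0, \<alpha> e 1} = \<phi> ` e"
      using ends[OF e] by (metis \<alpha>_def \<phi>_def image_comp image_empty image_insert)
  next
    fix e and t :: real assume "e \<in> E" "t \<in> {0<..<1}"
    then show "\<alpha> e t \<notin> \<phi> ` V"
      using vertex by (auto simp: \<alpha>_def \<phi>_def eq)
  next
    fix e e' assume e: "e \<in> E" and e': "e' \<in> E" and ne: "e \<noteq> e'"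
    show "\<alpha> e ` {0<..<1} \<inter> \<alpha> e' ` {0..1} = {}"
    proof (rule equals0I)
      fix p assume "p \<in> \<alpha> e ` {0<..<1} \<inter> \<alpha> e' ` {0..1}"
      then obtain t t' where t: "t \<in> {0<..<1}" "t' \<in> {0..1}" and "\<alpha> e t = \<alpha> e' t'"
        by (metis IntE imageE)
      then have "path e t = path e' t'" by (simp add: \<alpha>_def eq)
      with disj[OF e t(1) e' t(2) ne] show False ..
    qed
  qed
  moreover have \<Gamma>: "spatial_graph V E \<phi> \<alpha> = S3_point ` \<Gamma>"
    unfolding spatial_graph_def \<Gamma>_def \<phi>_def \<alpha>_def by (simp add: image_Un image_UN image_image)
  moreover have "?h ` S3_point ` \<Gamma> = S3_point ` \<Gamma>"
  proof -
    have order4: "rotoreflection (rotoreflection (rotoreflection (rotoreflection p))) = p" for p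
      by (simp add: rotoreflection_def)
    have "\<Gamma> \<subseteq> rotoreflection ` \<Gamma>"
    proof
      fix p assume "p \<in> \<Gamma>"
      then have "rotoreflection (rotoreflection (rotoreflection p)) \<in> \<Gamma>"
        using invariant by blast
      then show "p \<in> rotoreflection ` \<Gamma>"
        by (metis order4 imageI)
    qed
    with invariant have "rotoreflection ` \<Gamma> = \<Gamma>" by blast
    then show ?thesis
      by (simp only: image_image S3_point_rotoreflection) (metis image_image)
  qed
  ultimately show ?thesis
    unfolding achirally_embeddable_def using orientation_reversing_rotoreflection by metis
qed

section \<open>Drawing edges in an open book\<close>

text \<open>The half great spheres bounded by the circle \<open>{(u, 0). cmod u = 1}\<close> form an open book with one page
  for each unit vector \<open>z\<close>; \<open>page_point \<xi> z\<close> is the point above \<open>\<xi>\<close> in the disc model of page \<open>z\<close>.\<close>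

definition page_point :: "complex \<Rightarrow> complex \<Rightarrow> complex \<times> complex" where
  "page_point \<xi> z = (\<xi>, sqrt (1 - (cmod \<xi>)\<^sup>2) *\<^sub>R z)"

lemma norm_page_point: "cmod \<xi> \<le> 1 \<Longrightarrow> cmod z = 1 \<Longrightarrow> norm (page_point \<xi> z) = 1"
  by (simp add: page_point_def norm_prod_def abs_square_le_1)

text \<open>Over the open disc the factor of \<open>z\<close> is nonzero, so the page can be
  recovered; on the binding it vanishes and all pages meet.\<close>

lemma page_point_eq_iff:
  "cmod \<xi> < 1 \<Longrightarrow> page_point \<xi> z = page_point \<xi>' z' \<longleftrightarrow> \<xi> = \<xi>' \<and> z = z'"
  using abs_square_less_1[of "cmod \<xi>"] by (auto simp: page_point_def)

lemma page_point_unit: "cmod u = 1 \<Longrightarrow> page_point u z = (u, 0)"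
  by (simp add: page_point_def)

lemma page_point_0: "page_point 0 z = (0, z)"
  by (simp add: page_point_def)

lemma rotoreflection_page_point:
  "rotoreflection (page_point \<xi> z) = page_point (\<i> * \<xi>) (cnj z)"
  by (simp add: rotoreflection_def page_point_def norm_mult)

text \<open>\<open>Inl u\<close> stands for the point \<open>u\<close> on the binding of the book, \<open>Inr p\<close> for the point in direction \<open>p\<close>
  (not necessarily a unit vector) on the axis \<open>{(0, z). cmod z = 1}\<close>, on which the rotoreflection acts
  by complex conjugation.\<close>

fun place :: "complex + complex \<Rightarrow> complex \<times> complex" where
  "place (Inl u) = (u, 0)"
| "place (Inr p) = (0, sgn p)"

fun turn :: "complex + complex \<Rightarrow> complex + complex" where
  "turn (Inl u) = Inl (\<i> * u)"
| "turn (Inr p) = Inr (cnj p)"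

text \<open>The argument of \<open>g\<close> is the unordered pair of ends, so reversing a chord
  keeps its page. An edge between two axis directions is the straight segment pushed radially onto
  the axis, so the segment has to avoid 0.\<close>

fun edge_arc :: "(complex set \<Rightarrow> complex) \<Rightarrow> complex + complex \<Rightarrow> complex + complex \<Rightarrow> real \<Rightarrow> complex \<times> complex" where
  "edge_arc g (Inl u) (Inl v) t = page_point ((1 - t) *\<^sub>R u + t *\<^sub>R v) (g {u, v})"
| "edge_arc g (Inl u) (Inr p) t = page_point ((1 - t) *\<^sub>R u) (sgn p)"
| "edge_arc g (Inr p) (Inl u) t = page_point (t *\<^sub>R u) (sgn p)"
| "edge_arc g (Inr p) (Inr q) t = page_point 0 (sgn ((1 - t) *\<^sub>R p + t *\<^sub>R q))"

lemma edge_arc_reverse: "edge_arc g x y t = edge_arc g y x (1 - t)"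
  by (cases x; cases y) (simp_all add: add.commute insert_commute)

lemma edge_arc_reverse_image: "edge_arc g x y ` {0..1} = edge_arc g y x ` {0..1}"
proof -
  have "edge_arc g x y ` {0..1} = edge_arc g y x ` (\<lambda>t. 1 - t) ` {0..1}"
    unfolding image_image by (rule image_cong[OF refl edge_arc_reverse])
  then show ?thesis by simp
qed

lemma cnj_sgn: "cnj (sgn z) = sgn (cnj z)"
  by (simp add: sgn_div_norm)

lemma rotoreflection_place: "rotoreflection (place x) = place (turn x)"
  by (cases x) (simp_all add: rotoreflection_def cnj_sgn)

text \<open>Multiplication by \<open>\<i>\<close> is linear on the disc and conjugation commutes
  with \<open>sgn\<close>, so only the pages of chords impose a condition.\<close>

lemma rotoreflection_edge_arc:
  assumes "\<And>u v. x = Inl u \<Longrightarrow> y = Inl v \<Longrightarrow> g {\<i> * u, \<i> * v} = cnj (g {u, v})"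
  shows "rotoreflection (edge_arc g x y t) = edge_arc g (turn x) (turn y) t"
  using assms
  by (cases x; cases y) (simp_all add: rotoreflection_page_point cnj_sgn scaleR_conv_of_real algebra_simps)

lemma sgn_eq_imp_scaleR:
  fixes x y :: complex
  assumes "sgn x = sgn y" "x \<noteq> 0" "y \<noteq> 0"
  obtains c where "c > 0" "x = c *\<^sub>R y"
proof
  show "cmod x / cmod y > 0" using assms by simp
  have "x = cmod x *\<^sub>R sgn x" by (simp add: sgn_div_norm assms)
  then show "x = (cmod x / cmod y) *\<^sub>R y"
    unfolding assms(1) by (simp add: sgn_div_norm divide_inverse)
qed

text \<open>Strict convexity of the disc: the squared norm is 1 minus a positive multiple of
  \<open>1 - ?ip\<close>, and \<open>?ip < 1\<close> since \<open>u\<close> and \<open>v\<close> are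
  distinct unit vectors.\<close>

lemma chord_in_open_disc:
  fixes u v :: complex
  assumes "cmod u = 1" "cmod v = 1" "u \<noteq> v" "0 < t" "t < 1"
  shows "cmod ((1 - t) *\<^sub>R u + t *\<^sub>R v) < 1"
proof -
  let ?ip = "Re u * Re v + Im u * Im v"
  have sq: "(Re u)\<^sup>2 + (Im u)\<^sup>2 = 1" "(Re v)\<^sup>2 + (Im v)\<^sup>2 = 1"
    using assms(1,2) by (metis cmod_power2 one_power2)+
  have "0 < (cmod (u - v))\<^sup>2"
    using assms(3) by simp
  also have "(cmod (u - v))\<^sup>2 = 2 - 2 * ?ip"
    using sq unfolding cmod_power2 by (simp add: power2_eq_square algebra_simps)
  finally have ip: "?ip < 1" by simp
  have "(cmod ((1 - t) *\<^sub>R u + t *\<^sub>R v))\<^sup>2 =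
      (1 - t)\<^sup>2 * ((Re u)\<^sup>2 + (Im u)\<^sup>2) + t\<^sup>2 * ((Re v)\<^sup>2 + (Im v)\<^sup>2) + 2 * (t * (1 - t)) * ?ip"
    unfolding cmod_power2 by (simp add: power2_eq_square algebra_simps)
  also have "\<dots> = 1 - 2 * (t * (1 - t)) * (1 - ?ip)"
    unfolding sq by (simp add: power2_eq_square algebra_simps)
  also have "\<dots> < 1\<^sup>2"
    using ip assms(4,5) by simp
  finally show ?thesis
    by (rule power2_less_imp_less) simp
qed

text \<open>Comparing norms gives \<open>a = b\<close>. This identifies the chords that meet the
  axis as diameters.\<close>

lemma positive_combination_unit_eq_0:
  fixes u v :: complex
  assumes "cmod u = 1" "cmod v = 1" "0 < a" "0 < b" "a *\<^sub>R u + b *\<^sub>R v = 0"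
  shows "v = - u"
proof -
  have eq: "a *\<^sub>R u = - (b *\<^sub>R v)"
    using assms(5) by (simp add: eq_neg_iff_add_eq_0)
  then have "cmod (a *\<^sub>R u) = cmod (b *\<^sub>R v)"
    by (simp only: norm_minus_cancel)
  then have "a = b" using assms by simp
  with eq assms(3) have "u = - v"
    by (metis scaleR_cancel_left scaleR_minus_right less_irrefl)
  then show ?thesis by simp
qed

text \<open>Two chords lie in a common page only if the half turn \<open>\<xi> \<mapsto> - \<xi>\<close> exchanges them; the radii in
  the page \<open>sgn p\<close> are the edges at \<open>Inr p\<close>.  A chord meets the axis only if its ends are
  opposite, and then in the point \<open>g {u, - u}\<close>.\<close>

locale symmetric_spatial_graph =
  fixes V :: "(complex + complex) set" and E :: "(complex + complex) set set"
    and g :: "complex set \<Rightarrow> complex"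
  assumes unit: "Inl u \<in> V \<Longrightarrow> cmod u = 1"
    and nonzero: "Inr p \<in> V \<Longrightarrow> p \<noteq> 0"
    and rays: "\<lbrakk>Inr p \<in> V; Inr q \<in> V; c > 0; p = c *\<^sub>R q\<rbrakk> \<Longrightarrow> p = q"
    and turn_V: "x \<in> V \<Longrightarrow> turn x \<in> V"
    and turn_E: "{x, y} \<in> E \<Longrightarrow> {turn x, turn y} \<in> E"
    and edge: "e \<in> E \<Longrightarrow> \<exists>x\<in>V. \<exists>y\<in>V. x \<noteq> y \<and> e = {x, y}"
    and page_unit: "{Inl u, Inl v} \<in> E \<Longrightarrow> cmod (g {u, v}) = 1"
    and page_turn: "{Inl u, Inl v} \<in> E \<Longrightarrow> g {\<i> * u, \<i> * v} = cnj (g {u, v})"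
    and page_inj: "\<lbrakk>{Inl u, Inl v} \<in> E; {Inl u', Inl v'} \<in> E; g {u, v} = g {u', v'}\<rbrakk>
      \<Longrightarrow> {u', v'} = {u, v} \<or> {u', v'} = {- u, - v}"
    and page_vertex: "\<lbrakk>{Inl u, Inl v} \<in> E; Inr p \<in> V\<rbrakk> \<Longrightarrow> g {u, v} \<noteq> sgn p"
    and page_axis: "\<lbrakk>{Inl u, Inl (- u)} \<in> E; {Inr p, Inr q} \<in> E; a > 0; b > 0\<rbrakk>
      \<Longrightarrow> g {u, - u} \<noteq> sgn (a *\<^sub>R p + b *\<^sub>R q)"
    and axis_independent: "\<lbrakk>{Inr p, Inr q} \<in> E; a *\<^sub>R p + b *\<^sub>R q = 0\<rbrakk> \<Longrightarrow> a = 0 \<and> b = 0"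
    and axis_vertex: "\<lbrakk>{Inr p, Inr q} \<in> E; Inr r \<in> V; a > 0; b > 0; c > 0\<rbrakk>
      \<Longrightarrow> a *\<^sub>R p + b *\<^sub>R q \<noteq> c *\<^sub>R r"
    and axis_disjoint: "\<lbrakk>{Inr p, Inr q} \<in> E; {Inr p', Inr q'} \<in> E; a > 0; b > 0; c > 0; d > 0;
      a *\<^sub>R p + b *\<^sub>R q = c *\<^sub>R p' + d *\<^sub>R q'\<rbrakk> \<Longrightarrow> {p, q} = {p', q'}"
begin

section \<open>The arcs are simple and meet only at common vertices\<close>

lemma edgeD:
  assumes "{x, y} \<in> E"
  shows "x \<in> V" "y \<in> V" "x \<noteq> y"
proof -
  obtain x' y' where "x' \<in> V" "y' \<in> V" "x' \<noteq> y'" "{x, y} = {x', y'}"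
    using edge[OF assms] by blast
  then show "x \<in> V" "y \<in> V" "x \<noteq> y"
    by (auto simp: doubleton_eq_iff)
qed

lemma vertices:
  "{Inl u, y} \<in> E \<Longrightarrow> cmod u = 1" "{y, Inl u} \<in> E \<Longrightarrow> cmod u = 1"
  "{Inr p, y} \<in> E \<Longrightarrow> p \<noteq> 0" "{y, Inr p} \<in> E \<Longrightarrow> p \<noteq> 0"
  using edgeD unit nonzero by blast+

text \<open>Orienting mixed edges from the binding to the axis removes the third clause of
  \<open>edge_arc\<close> from the case analyses below.\<close>

lemma oriented_edge:
  assumes "e \<in> E"
  shows "\<exists>x y. e = {x, y} \<and> \<not> (isl y \<and> \<not> isl x)"
  using edge[OF assms] by (metis insert_commute)

lemma axis_nonzero:
  assumes "{Inr p, Inr q} \<in> E"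
  shows "(1 - t) *\<^sub>R p + t *\<^sub>R q \<noteq> 0"
  using axis_independent[OF assms, of "1 - t" t] by auto

text \<open>The locale compares directions by positive multiples, which keeps its conditions linear;
  this translates them back to points of the axis.\<close>

lemma sgn_eq: "\<lbrakk>Inr p \<in> V; Inr q \<in> V; sgn p = sgn q\<rbrakk> \<Longrightarrow> p = q"
  by (metis nonzero rays sgn_eq_imp_scaleR)

lemma norm_edge_arc:
  assumes "{x, y} \<in> E" "0 \<le> t" "t \<le> 1"
  shows "norm (edge_arc g x y t) = 1"
proof -
  have le: "cmod ((1 - t) *\<^sub>R u + t *\<^sub>R v) \<le> 1" if "cmod u = 1" "cmod v = 1" for u v
  proof -
    have "(1 - t) *\<^sub>R u + t *\<^sub>R v \<in> cball 0 1"
      using that assms by (intro convexD) auto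
    then show ?thesis by simp
  qed
  show ?thesis
    using assms vertices axis_nonzero
    by (cases x; cases y)
      (auto simp: le norm_sgn page_unit intro!: norm_page_point)
qed

lemma edge_arc_ends: "{x, y} \<in> E \<Longrightarrow> edge_arc g x y 0 = place x" "{x, y} \<in> E \<Longrightarrow> edge_arc g x y 1 = place y"
  using vertices by (cases x; cases y; simp add: page_point_unit page_point_0; fail)+

lemma continuous_on_edge_arc:
  assumes "{x, y} \<in> E"
  shows "continuous_on {0..1} (edge_arc g x y)"
proof (cases x; cases y)
  fix p q assume xy: "x = Inr p" "y = Inr q"
  have "continuous_on {0..1} (\<lambda>t. (0::complex, sgn ((1 - t) *\<^sub>R p + t *\<^sub>R q)))"
    unfolding sgn_div_norm using axis_nonzero assms xy
    by (intro continuous_intros) auto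
  then show ?thesis by (simp add: xy page_point_0 [abs_def])
qed (auto simp: page_point_def intro!: continuous_intros)

text \<open>Open chords and radii stay over the open disc and so avoid the binding. Over the centre,
  a radius has only an end, and a chord lies in a page excluded by \<open>page_vertex\<close>. For
  arcs of the axis the claim is \<open>axis_vertex\<close> after rescaling.\<close>

lemma edge_arc_meets_vertex:
  assumes xy: "{x, y} \<in> E" and or: "\<not> (isl y \<and> \<not> isl x)" and t: "0 < t" "t < 1" and w: "w \<in> V"
  shows "edge_arc g x y t \<noteq> place w"
proof
  assume eq: "edge_arc g x y t = place w"
  \<comment> \<open>The vertex is written as a page point so that \<open>page_point_eq_iff\<close>
    applies. A binding vertex lies in every page, and the value 0 for \<open>z'\<close> is
    arbitrary.\<close>
  obtain \<xi>' z' where w': "place w = page_point \<xi>' z'"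
    "Inl \<xi>' \<in> V \<or> \<xi>' = 0 \<and> (\<exists>r. Inr r \<in> V \<and> z' = sgn r)"
  proof (cases w)
    case (Inl u)
    with w unit that[of u 0] show thesis by (simp add: page_point_unit)
  next
    case (Inr r)
    with w that[of 0 "sgn r"] show thesis by (auto simp: page_point_0)
  qed
  show False
  proof (cases x; cases y)
    fix u v assume x: "x = Inl u" and y: "y = Inl v"
    then have uv: "cmod u = 1" "cmod v = 1" "u \<noteq> v"
      using xy vertices edgeD(3)[OF xy] by (auto simp: x y)
    note lt = chord_in_open_disc[OF uv t]
    have \<xi>': "\<xi>' = (1 - t) *\<^sub>R u + t *\<^sub>R v" and z': "z' = g {u, v}"
      using eq lt by (auto simp: x y w'(1) page_point_eq_iff)
    from w'(2) show False
    proof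
      assume "Inl \<xi>' \<in> V"
      with lt show False unfolding \<xi>' by (metis unit less_irrefl)
    next
      assume "\<xi>' = 0 \<and> (\<exists>r. Inr r \<in> V \<and> z' = sgn r)"
      with page_vertex xy show False by (auto simp: x y z')
    qed
  next
    fix u p assume x: "x = Inl u" and y: "y = Inr p"
    then have u: "cmod u = 1" using xy vertices by auto
    have lt: "cmod ((1 - t) *\<^sub>R u) < 1" using u t by simp
    have "\<xi>' = (1 - t) *\<^sub>R u"
      using eq lt by (auto simp: x y w'(1) page_point_eq_iff)
    with w'(2) u t lt unit show False by fastforce
  next
    fix p q assume x: "x = Inr p" and y: "y = Inr q"
    show False
    proof (cases w)
      case (Inl u)
      with eq w unit show ?thesis by (fastforce simp: x y page_point_0)
    next
      case (Inr r)
      then have "sgn ((1 - t) *\<^sub>R p + t *\<^sub>R q) = sgn r"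
        using eq by (simp add: x y page_point_0)
      then obtain c where "c > 0" "(1 - t) *\<^sub>R p + t *\<^sub>R q = c *\<^sub>R r"
        using sgn_eq_imp_scaleR axis_nonzero nonzero xy w Inr x y by metis
      then show False
        using axis_vertex[of p q r "1 - t" t c] xy t w Inr x y by auto
    qed
  qed (use or in auto)
qed

text \<open>Comparing the disc coordinate and the page of a common point settles most pairs of
  shapes; two chords in one page and two arcs of the axis need an argument of their own.\<close>

lemma edge_arcs_meet:
  assumes E: "{x, y} \<in> E" "{x', y'} \<in> E"
    and or: "\<not> (isl y \<and> \<not> isl x)" "\<not> (isl y' \<and> \<not> isl x')"
    and t: "0 < t" "t < 1" and t': "0 < t'" "t' < 1"
    and eq: "edge_arc g x y t = edge_arc g x' y' t'"
  shows "{x, y} = {x', y'}"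
proof -
  \<comment> \<open>In these labels \<open>f\<close> stands for an end on the binding, that is, in a
    free orbit, and \<open>a\<close> for an end on the axis.\<close>
  have ff_ff: "{u, v} = {u', v'}"
    if E: "{Inl u, Inl v} \<in> E" "{Inl u', Inl v'} \<in> E"
      and t: "0 < t" "t < 1" and t': "0 < t'" "t' < 1"
      and eq: "edge_arc g (Inl u) (Inl v) t = edge_arc g (Inl u') (Inl v') t'" for u v u' v' t t'
  proof -
    have uv: "cmod u = 1" "cmod v = 1" "u \<noteq> v"
      using E vertices edgeD(3)[OF E(1)] by auto
    have \<xi>: "(1 - t) *\<^sub>R u + t *\<^sub>R v = (1 - t') *\<^sub>R u' + t' *\<^sub>R v'" and "g {u, v} = g {u', v'}"
      using eq chord_in_open_disc[OF uv t] by (auto simp: page_point_eq_iff)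
    with page_inj E consider "{u', v'} = {u, v}" | "{u', v'} = {- u, - v}" by blast
    then show ?thesis
    proof cases
      case 2
      \<comment> \<open>For chords exchanged by the half turn, a common point yields a vanishing
        positive combination of \<open>u\<close> and \<open>v\<close>. The chord is then a diameter
        and coincides with its image.\<close>
      have "\<exists>a>0. \<exists>b>0. a *\<^sub>R u + b *\<^sub>R v = 0"
      proof (cases "u' = - u")
        case True
        with 2 have "v' = - v" by (auto simp: doubleton_eq_iff)
        with True \<xi> have "((1 - t) + (1 - t')) *\<^sub>R u + (t + t') *\<^sub>R v = 0"
          unfolding scaleR_add_left by (simp add: algebra_simps)
        moreover have "(1 - t) + (1 - t') > 0" "t + t' > 0" using t t' by auto
        ultimately show ?thesis by blast
      next
        case False
        with 2 have "v' = - u" "u' = - v" by (auto simp: doubleton_eq_iff)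
        with \<xi> have "((1 - t) + t') *\<^sub>R u + (t + (1 - t')) *\<^sub>R v = 0"
          unfolding scaleR_add_left by (simp add: algebra_simps)
        moreover have "(1 - t) + t' > 0" "t + (1 - t') > 0" using t t' by auto
        ultimately show ?thesis by blast
      qed
      with uv have "v = - u" using positive_combination_unit_eq_0 by blast
      with 2 show ?thesis by auto
    qed auto
  qed
  have ff_fa: False
    if E: "{Inl u, Inl v} \<in> E" "{Inl u', Inr p} \<in> E" and t: "0 < t" "t < 1"
      and eq: "edge_arc g (Inl u) (Inl v) t = edge_arc g (Inl u') (Inr p) t'" for u v u' p t t'
  proof -
    have uv: "cmod u = 1" "cmod v = 1" "u \<noteq> v"
      using E vertices edgeD(3)[OF E(1)] by auto
    show False
      using eq chord_in_open_disc[OF uv t] page_vertex[OF E(1)] edgeD(2)[OF E(2)]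
      by (auto simp: page_point_eq_iff)
  qed
  have ff_aa: False
    if E: "{Inl u, Inl v} \<in> E" "{Inr p, Inr q} \<in> E"
      and t: "0 < t" "t < 1" and t': "0 < t'" "t' < 1"
      and eq: "edge_arc g (Inl u) (Inl v) t = edge_arc g (Inr p) (Inr q) t'" for u v p q t t'
  proof -
    have uv: "cmod u = 1" "cmod v = 1" "u \<noteq> v"
      using E vertices edgeD(3)[OF E(1)] by auto
    have 0: "(1 - t) *\<^sub>R u + t *\<^sub>R v = 0" and g: "g {u, v} = sgn ((1 - t') *\<^sub>R p + t' *\<^sub>R q)"
      using eq chord_in_open_disc[OF uv t] by (auto simp: page_point_eq_iff)
    have "v = - u"
      using positive_combination_unit_eq_0[OF uv(1,2) _ _ 0] t by simp
    with g E page_axis[of u p q "1 - t'" t'] t' show False by simp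
  qed
  have fa_fa: "u = u' \<and> p = p'"
    if E: "{Inl u, Inr p} \<in> E" "{Inl u', Inr p'} \<in> E"
      and t: "0 < t" "t < 1" and t': "0 < t'" "t' < 1"
      and eq: "edge_arc g (Inl u) (Inr p) t = edge_arc g (Inl u') (Inr p') t'" for u p u' p' t t'
  proof -
    have u: "cmod u = 1" "cmod u' = 1" using E vertices by auto
    have \<xi>: "(1 - t) *\<^sub>R u = (1 - t') *\<^sub>R u'" and "sgn p = sgn p'"
      using eq u t by (auto simp: page_point_eq_iff)
    then have "p = p'" using sgn_eq E edgeD by blast
    have "cmod ((1 - t) *\<^sub>R u) = cmod ((1 - t') *\<^sub>R u')" using \<xi> by simp
    then have "1 - t = 1 - t'" using u t t' by simp
    with \<xi> t have "u = u'" by simp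
    with \<open>p = p'\<close> show ?thesis by simp
  qed
  have fa_aa: False
    if E: "{Inl u, Inr p} \<in> E" and t: "0 < t" "t < 1"
      and eq: "edge_arc g (Inl u) (Inr p) t = edge_arc g (Inr p') (Inr q') t'" for u p p' q' t t'
  proof -
    have u: "cmod u = 1" using E vertices by auto
    then have "(1 - t) *\<^sub>R u = 0"
      using eq t by (auto simp: page_point_eq_iff)
    with u t show False by auto
  qed
  have aa_aa: "{p, q} = {p', q'}"
    if E: "{Inr p, Inr q} \<in> E" "{Inr p', Inr q'} \<in> E"
      and t: "0 < t" "t < 1" and t': "0 < t'" "t' < 1"
      and eq: "edge_arc g (Inr p) (Inr q) t = edge_arc g (Inr p') (Inr q') t'" for p q p' q' t t'
  proof -
    have "sgn ((1 - t) *\<^sub>R p + t *\<^sub>R q) = sgn ((1 - t') *\<^sub>R p' + t' *\<^sub>R q')"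
      using eq by (simp add: page_point_0)
    then obtain c where c: "c > 0"
      "(1 - t) *\<^sub>R p + t *\<^sub>R q = c *\<^sub>R ((1 - t') *\<^sub>R p' + t' *\<^sub>R q')"
      using sgn_eq_imp_scaleR axis_nonzero E by metis
    then have "(1 - t) *\<^sub>R p + t *\<^sub>R q = (c * (1 - t')) *\<^sub>R p' + (c * t') *\<^sub>R q'"
      by (simp add: scaleR_add_right)
    then show ?thesis
      using axis_disjoint[OF E, of "1 - t" t "c * (1 - t')" "c * t'"] c t t' by simp
  qed
  show ?thesis
  proof (cases x; cases y; cases x'; cases y')
    fix u v u' v' assume [simp]: "x = Inl u" "y = Inl v" "x' = Inl u'" "y' = Inl v'"
    show ?thesis using ff_ff[of u v u' v'] E t t' eq by (auto simp: doubleton_eq_iff)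
  next
    fix u v u' p assume [simp]: "x = Inl u" "y = Inl v" "x' = Inl u'" "y' = Inr p"
    show ?thesis using ff_fa[of u v u' p t t'] E t t' eq by simp
  next
    fix u v p q assume [simp]: "x = Inl u" "y = Inl v" "x' = Inr p" "y' = Inr q"
    show ?thesis using ff_aa[of u v p q t t'] E t t' eq by simp
  next
    fix u p u' v' assume [simp]: "x = Inl u" "y = Inr p" "x' = Inl u'" "y' = Inl v'"
    show ?thesis using ff_fa[of u' v' u p t' t] E t t' eq by simp
  next
    fix u p u' p' assume [simp]: "x = Inl u" "y = Inr p" "x' = Inl u'" "y' = Inr p'"
    show ?thesis using fa_fa[of u p u' p' t t'] E t t' eq by simp
  next
    fix u p p' q' assume [simp]: "x = Inl u" "y = Inr p" "x' = Inr p'" "y' = Inr q'"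
    show ?thesis using fa_aa[of u p t p' q' t'] E t t' eq by simp
  next
    fix p q u v assume [simp]: "x = Inr p" "y = Inr q" "x' = Inl u" "y' = Inl v"
    show ?thesis using ff_aa[of u v p q t' t] E t t' eq by simp
  next
    fix p q u p' assume [simp]: "x = Inr p" "y = Inr q" "x' = Inl u" "y' = Inr p'"
    show ?thesis using fa_aa[of u p' t' p q t] E t t' eq by simp
  next
    fix p q p' q' assume [simp]: "x = Inr p" "y = Inr q" "x' = Inr p'" "y' = Inr q'"
    show ?thesis using aa_aa[of p q p' q'] E t t' eq by (auto simp: doubleton_eq_iff)
  qed (use or in simp_all)
qed

lemma inj_on_edge_arc:
  assumes xy: "{x, y} \<in> E"
  shows "inj_on (edge_arc g x y) {0..1}"
proof (rule inj_onI)
  fix s t assume eq: "edge_arc g x y s = edge_arc g x y t"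
  show "s = t"
  proof (cases x; cases y)
    fix u v assume x: "x = Inl u" and y: "y = Inl v"
    have "u \<noteq> v" using edgeD(3)[OF xy] x y by auto
    moreover have "(1 - s) *\<^sub>R u + s *\<^sub>R v = (1 - t) *\<^sub>R u + t *\<^sub>R v"
      using eq by (simp add: x y page_point_def)
    then have "(s - t) *\<^sub>R (v - u) = 0"
      by (simp add: algebra_simps)
    ultimately show ?thesis by simp
  next
    fix u p assume x: "x = Inl u" and y: "y = Inr p"
    have "u \<noteq> 0" using vertices(1)[of u y] xy x by auto
    with eq show ?thesis by (simp add: x y page_point_def)
  next
    fix u p assume x: "x = Inr p" and y: "y = Inl u"
    have "u \<noteq> 0" using vertices(2)[of x u] xy y by auto
    with eq show ?thesis by (simp add: x y page_point_def)
  next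
    fix p q assume x: "x = Inr p" and y: "y = Inr q"
    have "sgn ((1 - s) *\<^sub>R p + s *\<^sub>R q) = sgn ((1 - t) *\<^sub>R p + t *\<^sub>R q)"
      using eq by (simp add: x y page_point_0)
    then obtain c where "(1 - s) *\<^sub>R p + s *\<^sub>R q = c *\<^sub>R ((1 - t) *\<^sub>R p + t *\<^sub>R q)"
      using sgn_eq_imp_scaleR axis_nonzero xy x y by metis
    then have "((1 - s) - c * (1 - t)) *\<^sub>R p + (s - c * t) *\<^sub>R q = 0"
      by (simp add: algebra_simps)
    then have st: "(1 - s) - c * (1 - t) = 0" "s - c * t = 0"
      using axis_independent xy x y by blast+
    then have "c = 1" by (simp add: algebra_simps)
    with st show ?thesis by simp
  qed
qed

lemma inj_on_place: "inj_on place V"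
proof (rule inj_onI)
  fix x y assume V: "x \<in> V" "y \<in> V" and eq: "place x = place y"
  show "x = y"
  proof (cases x; cases y)
    fix p q assume "x = Inr p" "y = Inr q"
    with V eq sgn_eq show ?thesis by simp
  qed (use V eq unit in fastforce)+
qed

theorem achirally_embeddable:
  assumes inj: "inj_on f W" and W: "f ` W = V" and F: "(`) f ` F = E" "\<And>e. e \<in> F \<Longrightarrow> e \<subseteq> W"
  shows "achirally_embeddable W F"
proof -
  obtain a b where ab: "\<And>e. e \<in> E \<Longrightarrow> e = {a e, b e}"
    and or: "\<And>e. e \<in> E \<Longrightarrow> \<not> (isl (b e) \<and> \<not> isl (a e))"
    using oriented_edge by metis
  have abE: "{a e, b e} \<in> E" if "e \<in> E" for e
    using ab that by simp
  define path where "path = (\<lambda>e. edge_arc g (a (f ` e)) (b (f ` e)))"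
  have FE: "f ` e \<in> E" if "e \<in> F" for e using F that by blast
  \<comment> \<open>The rotoreflection may carry a chosen orientation of an edge to the opposite of
    the one chosen for its image; for invariance only the underlying sets of points matter.\<close>
  have image_arc: "edge_arc g x y ` {0..1} = edge_arc g (a {x, y}) (b {x, y}) ` {0..1}" if "{x, y} \<in> E" for x y
  proof -
    have "{x, y} = {a {x, y}, b {x, y}}" using ab[OF that] .
    then have "a {x, y} = x \<and> b {x, y} = y \<or> a {x, y} = y \<and> b {x, y} = x"
      unfolding doubleton_eq_iff by argo
    then show ?thesis by (metis edge_arc_reverse_image)
  qed
  let ?\<Gamma> = "(place \<circ> f) ` W \<union> (\<Union>e\<in>F. path e ` {0..1})"
  have \<Gamma>: "?\<Gamma> = place ` V \<union> (\<Union>e\<in>E. edge_arc g (a e) (b e) ` {0..1})"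
    unfolding path_def F(1)[symmetric] W[symmetric] by (simp add: image_comp)
  show ?thesis
  proof (rule achirally_embeddableI[where pos = "place \<circ> f" and path = path])
    show "inj_on (place \<circ> f) W"
      using inj inj_on_place W by (simp add: comp_inj_on)
    show "norm ((place \<circ> f) w) = 1" if "w \<in> W" for w
    proof -
      have "f w \<in> V" using W that by blast
      then show ?thesis using unit nonzero by (cases "f w") (auto simp: norm_prod_def norm_sgn)
    qed
    show "rotoreflection ` ?\<Gamma> \<subseteq> ?\<Gamma>"
      unfolding \<Gamma>
    proof (rule image_subsetI)
      fix p assume "p \<in> place ` V \<union> (\<Union>e\<in>E. edge_arc g (a e) (b e) ` {0..1})"
      then consider x where "x \<in> V" "p = place x"
        | e t where "e \<in> E" "t \<in> {0..1}" "p = edge_arc g (a e) (b e) t" by blast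
      then show "rotoreflection p \<in> place ` V \<union> (\<Union>e\<in>E. edge_arc g (a e) (b e) ` {0..1})"
      proof cases
        case 1
        then show ?thesis using turn_V by (auto simp: rotoreflection_place)
      next
        case 2
        let ?x = "turn (a e)" and ?y = "turn (b e)"
        have xy: "{?x, ?y} \<in> E" using turn_E[OF abE[OF 2(1)]] .
        have "rotoreflection p = edge_arc g ?x ?y t"
          unfolding 2(3) using abE[OF 2(1)] page_turn by (intro rotoreflection_edge_arc) simp
        then have "rotoreflection p \<in> edge_arc g (a {?x, ?y}) (b {?x, ?y}) ` {0..1}"
          using 2(2) image_arc[OF xy] by blast
        with xy show ?thesis by blast
      qed
    qed
  next
    fix e assume e: "e \<in> F"
    note E = abE[OF FE[OF e]]
    show "continuous_on {0..1} (path e)" "inj_on (path e) {0..1}"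
      unfolding path_def using continuous_on_edge_arc[OF E] inj_on_edge_arc[OF E] .
    have "f ` e = {a (f ` e), b (f ` e)}" using ab[OF FE[OF e]] .
    then show "{path e 0, path e 1} = (place \<circ> f) ` e"
      unfolding path_def edge_arc_ends[OF E] by (metis image_comp image_empty image_insert)
    show "e \<subseteq> W" using F e by blast
    show "norm (path e t) = 1" if "t \<in> {0..1}" for t
      unfolding path_def using norm_edge_arc[OF E] that by simp
    show "path e t \<noteq> (place \<circ> f) w" if "t \<in> {0<..<1}" "w \<in> W" for t w
      unfolding path_def comp_def
      using that W by (intro edge_arc_meets_vertex[OF E or[OF FE[OF e]]]) auto
    show "e = e'" if "e' \<in> F" "t \<in> {0<..<1}" "t' \<in> {0<..<1}" "path e t = path e' t'" for e' t t'
    proof -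
      have "{a (f ` e), b (f ` e)} = {a (f ` e'), b (f ` e')}"
        by (rule edge_arcs_meet[OF E abE[OF FE[OF that(1)]] or[OF FE[OF e]] or[OF FE[OF that(1)]], of t t'])
          (use that(2-) path_def in auto)
      then have "f ` e = f ` e'"
        using ab FE e that(1) by metis
      then show ?thesis
        using inj F(2) e that(1) by (metis inj_on_image_eq_iff)
    qed
  qed
qed

end

section \<open>Distributing the edges over the pages\<close>

text \<open>\<open>Re z < 0\<close> keeps the pages of chords away from the right half of the axis,
  and \<open>Im z > 0\<close> selects one page from each conjugate pair.\<close>

lemma infinite_page_directions:
  assumes "finite D"
  shows "infinite {z. cmod z = 1 \<and> Re z < 0 \<and> Im z > 0 \<and> z \<notin> D \<and> cnj z \<notin> D}"
proof -
  let ?z = "\<lambda>n. sgn (Complex (- 1) (Suc n))"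
  have ne: "Complex (- 1) (Suc n) \<noteq> 0" for n by (simp add: complex_eq_iff)
  have "inj ?z"
  proof (rule injI)
    fix m n assume "?z m = ?z n"
    then obtain c where "Complex (- 1) (Suc m) = c *\<^sub>R Complex (- 1) (Suc n)"
      using sgn_eq_imp_scaleR[OF _ ne ne] by metis
    then have "- 1 = - c" "real (Suc m) = c * real (Suc n)"
      unfolding complex_eq_iff by simp_all
    then show "m = n" by simp
  qed
  then have "infinite (range ?z)"
    by (simp add: finite_image_iff)
  then have "infinite (range ?z - (D \<union> cnj ` D))"
    using assms by (simp add: Diff_infinite_finite)
  moreover have "range ?z - (D \<union> cnj ` D) \<subseteq> {z. cmod z = 1 \<and> Re z < 0 \<and> Im z > 0 \<and> z \<notin> D \<and> cnj z \<notin> D}"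
  proof safe
    fix n
    show "cmod (?z n) = 1" using ne by (simp add: norm_sgn)
    have "cmod (Complex (- 1) (Suc n)) > 0" using ne by simp
    then show "Re (?z n) < 0" "Im (?z n) > 0"
      by (simp_all add: sgn_div_norm divide_pos_pos)
    assume "cnj (?z n) \<in> D" "?z n \<notin> cnj ` D"
    then show False by (metis complex_cnj_cnj imageI)
  qed
  ultimately show ?thesis using finite_subset by blast
qed

lemma finite_inj_into_infinite:
  assumes "finite A" "infinite B"
  obtains f where "inj_on f A" "f ` A \<subseteq> B"
proof -
  obtain B' where "finite B'" "card B' = card A" "B' \<subseteq> B"
    using infinite_arbitrarily_large[OF assms(2)] by blast
  then show thesis
    using that finite_same_card_bij[OF assms(1)] by (metis bij_betw_def)
qed

text \<open>Two quarter turns give negation. Each orbit of edges receives one conjugate pair of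
  pages, and successive edges alternate between the two. Different orbits get different pairs
  because \<open>g0\<close> is injective with values in the upper half plane.\<close>

lemma page_assignment:
  fixes X :: "complex set set"
  assumes fin: "finite X" "finite D"
    and X: "\<And>e. e \<in> X \<Longrightarrow> (*) \<i> ` e \<in> X"
    and pair: "\<And>e. e \<in> X \<Longrightarrow> \<exists>u v. e = {u, v} \<and> u \<noteq> 0 \<and> v \<noteq> 0 \<and> u \<noteq> v"
  shows "\<exists>g. (\<forall>e\<in>X. cmod (g e) = 1 \<and> Re (g e) < 0 \<and> g e \<notin> D \<and> g ((*) \<i> ` e) = cnj (g e))
    \<and> (\<forall>e\<in>X. \<forall>e'\<in>X. g e = g e' \<longrightarrow> e' = e \<or> e' = uminus ` e)"
proof -
  define T where "T = {z. cmod z = 1 \<and> Re z < 0 \<and> Im z > 0 \<and> z \<notin> D \<and> cnj z \<notin> D}"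
  obtain g0 where inj: "inj_on g0 X" and g0: "g0 ` X \<subseteq> T"
    using finite_inj_into_infinite[OF fin(1) infinite_page_directions[OF fin(2)]] unfolding T_def by blast
  define R where "R = image ((*) \<i>)"
  have RR: "R (R e) = uminus ` e" for e
    by (simp add: R_def image_image)
  have R4: "R (R (R (R e))) = e" for e
    by (simp add: RR image_image)
  have RX: "R e \<in> X" if "e \<in> X" for e using X that by (simp add: R_def)
  \<comment> \<open>An invariant edge would need a page equal to its own conjugate.\<close>
  have R_neq: "R e \<noteq> e" if "e \<in> X" for e
  proof
    assume eq: "R e = e"
    obtain u v where e: "e = {u, v}" "u \<noteq> 0" "v \<noteq> 0" "u \<noteq> v" using pair[OF \<open>e \<in> X\<close>] by blast
    have i: "\<i> * w \<noteq> w" if "w \<noteq> 0" for w using that by (auto simp: complex_eq_iff)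
    have "\<i> * u = v" "\<i> * v = u"
      using eq e i[of u] i[of v] by (auto simp: R_def doubleton_eq_iff)
    then have "- u = u" by (metis i_squared mult.assoc mult_minus1 power2_eq_square)
    with e show False by simp
  qed
  define orb where "orb e = {e, R e, R (R e), R (R (R e))}" for e
  \<comment> \<open>The choice is made from the set \<open>orb e\<close>, so \<open>r\<close> is
    constant on each orbit; \<open>pos\<close> then marks the even powers of \<open>R\<close>
    applied to this representative.\<close>
  define r where "r e = (SOME e'. e' \<in> orb e)" for e
  have "r e \<in> orb e" for e unfolding r_def by (rule someI[of _ e]) (simp add: orb_def)
  then have r: "r e = e \<or> r e = R e \<or> r e = R (R e) \<or> r e = R (R (R e))" for e
    by (simp add: orb_def)
  have rX: "r e \<in> X" if "e \<in> X" for e using r[of e] RX that by metis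
  have "orb (R e) = orb e" for e by (auto simp: orb_def R4)
  then have rR: "r (R e) = r e" for e by (simp add: r_def)
  define pos where "pos e \<longleftrightarrow> e = r e \<or> e = R (R (r e))" for e
  have pos_R: "pos (R e) \<longleftrightarrow> \<not> pos e" if e: "e \<in> X" for e
  proof -
    have neq: "R e \<noteq> e" "e \<noteq> R e" "R e \<noteq> R (R e)" "e \<noteq> R (R (R e))"
      using R_neq[OF e] R_neq[OF RX[OF e]] R4[of e] by auto
    from r[of e] show ?thesis
      unfolding pos_def rR by (elim disjE; simp only: neq R4 simp_thms)
  qed
  define g where "g e = (if pos e then g0 (r e) else cnj (g0 (r e)))" for e
  have g0T: "g0 (r e) \<in> T" if "e \<in> X" for e using g0 rX that by blast
  show ?thesis
  proof (rule exI[of _ g], rule conjI; intro ballI impI)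
    fix e assume e: "e \<in> X"
    have "cmod (g e) = 1 \<and> Re (g e) < 0 \<and> g e \<notin> D"
      using g0T[OF e] by (simp add: g_def T_def)
    moreover have "g ((*) \<i> ` e) = cnj (g e)"
      using pos_R[OF e] by (simp add: g_def rR flip: R_def)
    ultimately show "cmod (g e) = 1 \<and> Re (g e) < 0 \<and> g e \<notin> D \<and> g ((*) \<i> ` e) = cnj (g e)"
      by blast
  next
    fix e e' assume e: "e \<in> X" "e' \<in> X" and eq: "g e = g e'"
    have Im: "Im (g0 (r e)) > 0" "Im (g0 (r e')) > 0"
      using g0T e by (auto simp: T_def)
    then have "Im (g e) > 0 \<longleftrightarrow> pos e" "Im (g e') > 0 \<longleftrightarrow> pos e'"
      by (simp_all add: g_def)
    then have same: "pos e \<longleftrightarrow> pos e'" by (simp add: eq)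
    with eq have "g0 (r e) = g0 (r e')"
      by (auto simp: g_def split: if_splits)
    then have rr: "r e = r e'" using inj rX e by (auto dest: inj_onD)
    have neg: "e = R (r e) \<or> e = R (R (R (r e)))" if "\<not> pos e" for e
      using r[of e] that unfolding pos_def by (elim disjE) (simp_all only: R4 simp_thms)
    have *: "e' = e \<or> e' = R (R e)"
      if "e = c \<or> e = R (R c)" "e' = c \<or> e' = R (R c)" for c
      using that R4[of c] by auto
    have "e' = e \<or> e' = R (R e)"
    proof (cases "pos e")
      case True
      then show ?thesis using same by (intro *[of "r e"]) (simp_all add: pos_def rr)
    next
      case False
      then show ?thesis using same neg[of e] neg[of e'] by (intro *[of "R (r e)"]) (simp_all only: rr simp_thms)
    qed
    then show "e' = e \<or> e' = uminus ` e" by (simp add: RR)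
  qed
qed

section \<open>Symmetric complete multipartite graphs\<close>

text \<open>These points lie in the open first quadrant, so the four powers of \<open>\<i>\<close>
  move them to four different quadrants and the orbits are free and disjoint.\<close>

definition base_point :: "nat \<Rightarrow> complex" where
  "base_point n = sgn (Complex 1 (Suc n))"

lemma base_point: "cmod (base_point n) = 1" "Re (base_point n) > 0" "Im (base_point n) > 0"
proof -
  have "Complex 1 (Suc n) \<noteq> 0" by (simp add: complex_eq_iff)
  then have "cmod (Complex 1 (Suc n)) > 0" by simp
  then show "cmod (base_point n) = 1" "Re (base_point n) > 0" "Im (base_point n) > 0"
    using \<open>Complex 1 (Suc n) \<noteq> 0\<close>
    by (simp_all add: base_point_def norm_sgn sgn_div_norm divide_pos_pos)
qed

lemma inj_base_point: "inj base_point"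
proof (rule injI)
  fix m n assume "base_point m = base_point n"
  moreover have "Complex 1 (Suc n) \<noteq> 0" for n by (simp add: complex_eq_iff)
  ultimately obtain c where "Complex 1 (Suc m) = c *\<^sub>R Complex 1 (Suc n)"
    unfolding base_point_def using sgn_eq_imp_scaleR by metis
  then have "1 = c" "real (Suc m) = c * real (Suc n)"
    unfolding complex_eq_iff by simp_all
  then show "m = n" by simp
qed

text \<open>A label \<open>(k, s, m)\<close> stands for the \<open>k\<close>-th turn of the
  \<open>m\<close>-th base point of colour \<open>s\<close>; \<open>prod_encode\<close> keeps base
  points of different colours apart.\<close>

fun orbit_point :: "nat \<times> nat \<times> nat \<Rightarrow> complex" where
  "orbit_point (k, s, m) = \<i> ^ k * base_point (prod_encode (s, m))"

lemma less_4_cases: "k < (4::nat) \<Longrightarrow> k = 0 \<or> k = 1 \<or> k = 2 \<or> k = 3"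
  by auto

lemma inj_on_orbit_point: "inj_on orbit_point ({..<4} \<times> UNIV)"
proof (rule inj_onI)
  fix x y assume xy: "x \<in> {..<4} \<times> UNIV" "y \<in> {..<4} \<times> UNIV" and eq: "orbit_point x = orbit_point y"
  obtain k s m k' s' m' where [simp]: "x = (k, s, m)" "y = (k', s', m')"
    by (cases x, cases y) auto
  let ?n = "prod_encode (s, m)" and ?n' = "prod_encode (s', m')"
  have k: "k = 0 \<or> k = 1 \<or> k = 2 \<or> k = 3" "k' = 0 \<or> k' = 1 \<or> k' = 2 \<or> k' = 3"
    using xy less_4_cases by auto
  have "Re (orbit_point x) = Re (orbit_point y)" "Im (orbit_point x) = Im (orbit_point y)"
    using eq by simp_all
  with k have "k = k'"
    using base_point(2,3)[of ?n] base_point(2,3)[of ?n']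
    by (elim disjE) (simp_all add: power3_eq_cube)
  with eq have "base_point ?n = base_point ?n'" by simp
  with \<open>k = k'\<close> show "x = y"
    using inj_base_point by (simp add: inj_eq prod_encode_eq)
qed

lemma funpow_2_3: "(h ^^ 2) x = h (h x)" "(h ^^ 3) x = h (h (h x))"
  by (simp_all add: eval_nat_numeral)

text \<open>The parts are the colour classes.  The symmetry of order four permutes them by \<open>\<tau>\<close>; there are \<open>f s\<close>
  free orbits whose base point has colour \<open>s\<close>, and the remaining vertices lie in the directions
  \<open>D\<close> on the axis.\<close>

locale symmetric_parts =
  fixes ms :: "nat list" and \<tau> f :: "nat \<Rightarrow> nat" and D :: "complex set" and axis_colour :: "complex \<Rightarrow> nat"
  assumes tau_less: "j < length ms \<Longrightarrow> \<tau> j < length ms"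
    and tau_4: "j < length ms \<Longrightarrow> \<tau> (\<tau> (\<tau> (\<tau> j))) = j"
    and sizes: "j < length ms \<Longrightarrow>
      ms ! j = f j + f (\<tau> j) + f (\<tau> (\<tau> j)) + f (\<tau> (\<tau> (\<tau> j))) + card {p \<in> D. axis_colour p = j}"
    and finite_axis: "finite D"
    and axis_nonzero: "p \<in> D \<Longrightarrow> p \<noteq> 0"
    and axis_colour_less: "p \<in> D \<Longrightarrow> axis_colour p < length ms"
    and axis_cnj: "p \<in> D \<Longrightarrow> cnj p \<in> D" "p \<in> D \<Longrightarrow> axis_colour (cnj p) = \<tau> (axis_colour p)"
    and axis_rays: "\<lbrakk>p \<in> D; q \<in> D; c > 0; p = c *\<^sub>R q\<rbrakk> \<Longrightarrow> p = q"
    and axis_independent: "\<lbrakk>p \<in> D; q \<in> D; axis_colour p \<noteq> axis_colour q; a *\<^sub>R p + b *\<^sub>R q = 0\<rbrakk> \<Longrightarrow> a = 0 \<and> b = 0"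
    and axis_vertex: "\<lbrakk>p \<in> D; q \<in> D; axis_colour p \<noteq> axis_colour q; r \<in> D; a > 0; b > 0; c > 0\<rbrakk>
      \<Longrightarrow> a *\<^sub>R p + b *\<^sub>R q \<noteq> c *\<^sub>R r"
    and axis_disjoint: "\<lbrakk>p \<in> D; q \<in> D; axis_colour p \<noteq> axis_colour q;
      p' \<in> D; q' \<in> D; axis_colour p' \<noteq> axis_colour q'; a > 0; b > 0; c > 0; d > 0;
      a *\<^sub>R p + b *\<^sub>R q = c *\<^sub>R p' + d *\<^sub>R q'\<rbrakk> \<Longrightarrow> {p, q} = {p', q'}"
    and axis_side: "(\<forall>p\<in>D. Re p > 0) \<or> (\<forall>s<length ms. f s > 0 \<longrightarrow> \<tau> (\<tau> s) = s)"
begin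

section \<open>The coloured vertex set and its symmetry\<close>

definition labels :: "(nat \<times> nat \<times> nat) set" where
  "labels = {(k, s, m). k < 4 \<and> s < length ms \<and> m < f s}"

definition vertices :: "(complex + complex) set" where
  "vertices = Inl ` orbit_point ` labels \<union> Inr ` D"

fun colour :: "complex + complex \<Rightarrow> nat" where
  "colour (Inl u) = (case inv_into ({..<4} \<times> UNIV) orbit_point u of (k, s, m) \<Rightarrow> (\<tau> ^^ k) s)"
| "colour (Inr p) = axis_colour p"

definition edges :: "(complex + complex) set set" where
  "edges = {{x, y} | x y. x \<in> vertices \<and> y \<in> vertices \<and> colour x \<noteq> colour y}"

lemma edges_iff: "{x, y} \<in> edges \<longleftrightarrow> x \<in> vertices \<and> y \<in> vertices \<and> colour x \<noteq> colour y"
  by (auto simp: edges_def doubleton_eq_iff)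

lemma colour_orbit_point: "k < 4 \<Longrightarrow> colour (Inl (orbit_point (k, s, m))) = (\<tau> ^^ k) s"
  using inv_into_f_f[OF inj_on_orbit_point, of "(k, s, m)"] by simp

lemma vertices_cases:
  assumes "x \<in> vertices"
  obtains (orbit) k s m where "x = Inl (orbit_point (k, s, m))" "k < 4" "s < length ms" "m < f s"
  | (axis) p where "x = Inr p" "p \<in> D"
  using assms by (auto simp: vertices_def labels_def)

lemma vertices_iff:
  "k < 4 \<Longrightarrow> Inl (orbit_point (k, s, m)) \<in> vertices \<longleftrightarrow> s < length ms \<and> m < f s"
  "Inr p \<in> vertices \<longleftrightarrow> p \<in> D"
proof -
  assume "k < 4"
  then show "Inl (orbit_point (k, s, m)) \<in> vertices \<longleftrightarrow> s < length ms \<and> m < f s"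
    using inj_on_image_mem_iff[OF inj_on_orbit_point, of "(k, s, m)" labels]
    by (auto simp: vertices_def labels_def simp del: orbit_point.simps)
qed (auto simp: vertices_def)

lemma funpow_tau_less: "s < length ms \<Longrightarrow> (\<tau> ^^ k) s < length ms"
  by (induction k) (auto simp: tau_less)

lemma colour_less: "x \<in> vertices \<Longrightarrow> colour x < length ms"
  by (erule vertices_cases)
    (simp_all add: colour_orbit_point funpow_tau_less axis_colour_less del: orbit_point.simps colour.simps(1))

lemma turn_orbit_point:
  assumes "k < 4"
  shows "turn (Inl (orbit_point (k, s, m))) = Inl (orbit_point (Suc k mod 4, s, m))"
  using less_4_cases[OF assms] by (elim disjE) (simp_all add: power3_eq_cube)

text \<open>That the fourth power of \<open>\<tau>\<close> is the identity makes the step from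
  \<open>k = 3\<close> back to \<open>k = 0\<close> agree with the colours.\<close>

lemma turn_vertices:
  assumes "x \<in> vertices"
  shows "turn x \<in> vertices \<and> colour (turn x) = \<tau> (colour x)"
  using assms
proof (cases rule: vertices_cases)
  case (orbit k s m)
  have "(\<tau> ^^ (Suc k mod 4)) s = \<tau> ((\<tau> ^^ k) s)"
    using less_4_cases[OF orbit(2)] tau_4[OF orbit(3)] by (elim disjE) (simp_all add: funpow_2_3)
  then show ?thesis
    unfolding orbit(1) turn_orbit_point[OF orbit(2)]
    using orbit by (simp_all add: vertices_iff colour_orbit_point del: orbit_point.simps colour.simps(1))
next
  case (axis p)
  then show ?thesis
    using axis_cnj by (simp_all add: vertices_iff)
qed

lemma turn_edges:
  assumes "{x, y} \<in> edges"
  shows "{turn x, turn y} \<in> edges"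
proof -
  have xy: "x \<in> vertices" "y \<in> vertices" "colour x \<noteq> colour y"
    using assms by (simp_all add: edges_iff)
  have "\<tau> (colour x) \<noteq> \<tau> (colour y)"
    using tau_4[OF colour_less[OF xy(1)]] tau_4[OF colour_less[OF xy(2)]] xy(3) by metis
  then show ?thesis
    using turn_vertices xy by (simp add: edges_iff)
qed

lemma unit_vertices:
  assumes "Inl u \<in> vertices"
  shows "cmod u = 1"
  using assms by (cases rule: vertices_cases) (auto simp: norm_mult norm_power base_point)

lemma finite_labels: "finite labels"
proof -
  have "labels \<subseteq> {..<4} \<times> (SIGMA s:{..<length ms}. {..<f s})"
    by (auto simp: labels_def)
  then show ?thesis by (rule finite_subset) auto
qed

lemma finite_vertices: "finite vertices"
  using finite_labels finite_axis by (simp add: vertices_def)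

text \<open>A point labelled \<open>(k, s, m)\<close> has colour \<open>(\<tau> ^^ k) s\<close>, so
  class \<open>j\<close> receives the \<open>k\<close>-th points of the orbits based at
  \<open>(\<tau> ^^ (4 - k)) j\<close>. If \<open>\<tau>\<close> has a shorter cycle at
  \<open>j\<close>, some of these bases coincide, but each \<open>k\<close> still counts
  separately.\<close>

lemma card_colour_class:
  assumes j: "j < length ms"
  shows "card {x \<in> vertices. colour x = j} = ms ! j"
proof -
  let ?F = "{l \<in> labels. case l of (k, s, m) \<Rightarrow> (\<tau> ^^ k) s = j}"
  define A B :: "(complex + complex) set"
    where "A = Inl ` orbit_point ` ?F" and "B = Inr ` {p \<in> D. axis_colour p = j}"
  let ?S = "\<lambda>k s. {k::nat} \<times> {s::nat} \<times> {..<f s}"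
  have "{x \<in> vertices. colour x = j} = A \<union> B" (is "?L = ?R")
  proof (intro equalityI subsetI)
    fix x assume "x \<in> ?L"
    then have x: "x \<in> vertices" "colour x = j" by auto
    from x(1) show "x \<in> ?R"
    proof (cases rule: vertices_cases)
      case (orbit k s m)
      with x have "(k, s, m) \<in> ?F" by (simp add: labels_def colour_orbit_point del: orbit_point.simps colour.simps(1))
      then show ?thesis unfolding orbit(1) A_def by blast
    next
      case (axis p)
      with x show ?thesis by (auto simp: B_def)
    qed
  next
    fix x assume "x \<in> ?R"
    then consider l where "x = Inl (orbit_point l)" "l \<in> ?F" | p where "x = Inr p" "p \<in> D" "axis_colour p = j"
      unfolding A_def B_def by blast
    then show "x \<in> ?L"
    proof cases
      case 1
      then show ?thesis
        by (auto simp: labels_def vertices_iff colour_orbit_point simp del: orbit_point.simps colour.simps(1))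
    qed (simp add: vertices_iff)
  qed
  moreover have "card A = card ?F"
  proof -
    have "inj_on orbit_point ?F"
      using inj_on_orbit_point by (rule inj_on_subset) (auto simp: labels_def)
    then show ?thesis by (simp add: A_def card_image)
  qed
  moreover have "card B = card {p \<in> D. axis_colour p = j}"
    by (simp add: B_def card_image)
  moreover have "card (A \<union> B) = card A + card B"
    using finite_labels finite_axis by (intro card_Un_disjoint) (auto simp: A_def B_def)
  ultimately have "card {x \<in> vertices. colour x = j} = card ?F + card {p \<in> D. axis_colour p = j}"
    by presburger
  moreover have "?F = ?S 0 j \<union> ?S 1 (\<tau> (\<tau> (\<tau> j))) \<union> ?S 2 (\<tau> (\<tau> j)) \<union> ?S 3 (\<tau> j)" (is "_ = ?U")
  proof (intro equalityI subsetI)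
    fix l assume "l \<in> ?F"
    then obtain k s m where l: "l = (k, s, m)" "k < 4" "s < length ms" "m < f s" "(\<tau> ^^ k) s = j"
      by (auto simp: labels_def)
    note t4 = tau_4[OF l(3)]
    from less_4_cases[OF l(2)] consider "k = 0" | "k = 1" | "k = 2" | "k = 3" by blast
    then show "l \<in> ?U"
    proof cases
      case 3
      then have "\<tau> (\<tau> j) = s" using l(5) t4 by (simp add: funpow_2_3)
      then show ?thesis using 3 l by simp
    next
      case 4
      then have "\<tau> j = s" using l(5) t4 by (simp add: funpow_2_3)
      then show ?thesis using 4 l by simp
    qed (use l t4 in auto)
  next
    fix l assume "l \<in> ?U"
    then show "l \<in> ?F"
      using tau_4[OF j] j tau_less[OF j] tau_less[OF tau_less[OF j]] tau_less[OF tau_less[OF tau_less[OF j]]]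
      by (auto simp: labels_def funpow_2_3)
  qed
  moreover have "card ?U = f j + f (\<tau> (\<tau> (\<tau> j))) + f (\<tau> (\<tau> j)) + f (\<tau> j)"
    by (subst card_Un_disjoint; auto simp: card_cartesian_product)+
  ultimately show ?thesis using sizes[OF j] by simp
qed

lemma Re_sgn_pos:
  assumes "Re z > 0"
  shows "Re (sgn z) > 0"
proof -
  have "z \<noteq> 0" using assms by auto
  with assms show ?thesis by (simp add: sgn_div_norm divide_pos_pos)
qed

lemma finite_free_pairs: "finite {{u, v} | u v. {Inl u, Inl v} \<in> edges}"
proof (rule finite_subset)
  show "{{u, v} | u v. {Inl u, Inl v} \<in> edges} \<subseteq> Pow (Inl -` vertices)"
    by (auto simp: edges_iff)
  show "finite (Pow (Inl -` vertices :: complex set))"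
    by (simp add: finite_vimageI[OF finite_vertices])
qed

text \<open>Opposite vertices \<open>u\<close> and \<open>- u\<close> carry the colours \<open>c\<close> and \<open>\<tau> (\<tau> c)\<close>, so chords through the
  axis occur only if \<open>\<tau> \<circ> \<tau>\<close> moves the colour of a nonempty orbit.\<close>

lemma opposite_edge_imp_axis_side:
  assumes "{Inl u, Inl (- u)} \<in> edges" "p \<in> D"
  shows "Re p > 0"
proof -
  have u: "Inl u \<in> vertices" and ne: "colour (Inl u) \<noteq> colour (Inl (- u))"
    using assms by (simp_all add: edges_iff)
  have "turn (turn (Inl u)) = Inl (- u)"
    by (simp flip: mult.assoc)
  then have "colour (Inl (- u)) = \<tau> (\<tau> (colour (Inl u)))"
    using turn_vertices u by metis
  with ne have ne': "\<tau> (\<tau> (colour (Inl u))) \<noteq> colour (Inl u)" by metis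
  from u show ?thesis
  proof (cases rule: vertices_cases)
    case (orbit k s m)
    have "\<tau> (\<tau> ((\<tau> ^^ k) s)) = (\<tau> ^^ k) (\<tau> (\<tau> s))"
      by (metis funpow_swap1)
    with ne' orbit have "\<tau> (\<tau> s) \<noteq> s"
      using colour_orbit_point by metis
    with orbit axis_side assms(2) show ?thesis by fastforce
  qed simp
qed

text \<open>The list \<open>ms\<close> is ordered to suit the symmetry; \<open>p\<close> transfers
  the result to any other order of the parts.\<close>

theorem achirally_embeddable_cmp:
  assumes p: "bij_betw p {..<length ms'} {..<length ms}"
    and ms': "\<And>i. i < length ms' \<Longrightarrow> ms' ! i = ms ! p i"
  shows "achirally_embeddable (cmp_vertices ms') (cmp_edges ms')"
proof -
  define X where "X = {{u, v} | u v. {Inl u, Inl v} \<in> edges}"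
  have X: "{u, v} \<in> X \<longleftrightarrow> {Inl u, Inl v} \<in> edges" for u v
    by (auto simp: X_def doubleton_eq_iff insert_commute)
  have pair: "\<exists>u v. e = {u, v} \<and> u \<noteq> 0 \<and> v \<noteq> 0 \<and> u \<noteq> v" if "e \<in> X" for e
  proof -
    obtain u v where uv: "e = {u, v}" "{Inl u, Inl v} \<in> edges"
      using \<open>e \<in> X\<close> unfolding X_def by blast
    then have "cmod u = 1" "cmod v = 1" "u \<noteq> v"
      using unit_vertices by (auto simp: edges_iff simp del: colour.simps)
    with uv(1) show ?thesis by force
  qed
  have turn_X: "(*) \<i> ` e \<in> X" if "e \<in> X" for e
  proof -
    obtain u v where uv: "e = {u, v}" "{Inl u, Inl v} \<in> edges"
      using \<open>e \<in> X\<close> unfolding X_def by blast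
    then have "{\<i> * u, \<i> * v} \<in> X"
      using turn_edges[OF uv(2)] by (simp add: X)
    with uv(1) show ?thesis by simp
  qed
  have fin: "finite X" "finite (sgn ` D)"
    using finite_free_pairs finite_axis by (simp_all add: X_def)
  \<comment> \<open>The pages in the directions of \<open>D\<close> are excluded because they carry
    the radii.\<close>
  have "\<exists>g. (\<forall>e\<in>X. cmod (g e) = 1 \<and> Re (g e) < 0 \<and> g e \<notin> sgn ` D \<and> g ((*) \<i> ` e) = cnj (g e))
    \<and> (\<forall>e\<in>X. \<forall>e'\<in>X. g e = g e' \<longrightarrow> e' = e \<or> e' = uminus ` e)"
    using fin turn_X pair by (rule page_assignment)
  then obtain g where "\<forall>e\<in>X. cmod (g e) = 1 \<and> Re (g e) < 0 \<and> g e \<notin> sgn ` D \<and> g ((*) \<i> ` e) = cnj (g e)"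
    and "\<forall>e\<in>X. \<forall>e'\<in>X. g e = g e' \<longrightarrow> e' = e \<or> e' = uminus ` e"
    by (elim exE conjE)
  then have g: "\<And>e. e \<in> X \<Longrightarrow> cmod (g e) = 1 \<and> Re (g e) < 0 \<and> g e \<notin> sgn ` D"
      "\<And>e. e \<in> X \<Longrightarrow> g ((*) \<i> ` e) = cnj (g e)"
      "\<And>e e'. e \<in> X \<Longrightarrow> e' \<in> X \<Longrightarrow> g e = g e' \<Longrightarrow> e' = e \<or> e' = uminus ` e"
    by simp_all
  interpret G: symmetric_spatial_graph vertices edges g
  proof
    fix u v assume uv: "{Inl u, Inl v} \<in> edges"
    show "cmod (g {u, v}) = 1" using g(1) uv X by blast
    show "g {\<i> * u, \<i> * v} = cnj (g {u, v})" using g(2)[of "{u, v}"] uv X by simp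
    show "g {u, v} \<noteq> sgn q" if "Inr q \<in> vertices" for q
      using g(1)[of "{u, v}"] uv X that by (auto simp: vertices_iff)
    show "{u', v'} = {u, v} \<or> {u', v'} = {- u, - v}"
      if "{Inl u', Inl v'} \<in> edges" "g {u, v} = g {u', v'}" for u' v'
      using g(3)[of "{u, v}" "{u', v'}"] uv that X by simp
  next
    fix u q r a b
    assume uu: "{Inl u, Inl (- u)} \<in> edges" and qr: "{Inr q, Inr r} \<in> edges" and ab: "0 < (a::real)" "0 < (b::real)"
    \<comment> \<open>When diameters occur, all axis edges lie in the right half plane, while the
      pages of chords point to the left.\<close>
    have "Re q > 0" "Re r > 0"
      using opposite_edge_imp_axis_side[OF uu] qr by (simp_all add: edges_iff vertices_iff)
    then have "Re (a *\<^sub>R q + b *\<^sub>R r) > 0" using ab by (simp add: add_pos_pos)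
    then have "Re (sgn (a *\<^sub>R q + b *\<^sub>R r)) > 0" by (rule Re_sgn_pos)
    moreover have "Re (g {u, - u}) < 0" using g(1) uu X by blast
    ultimately show "g {u, - u} \<noteq> sgn (a *\<^sub>R q + b *\<^sub>R r)" by auto
  next
    fix x y assume "{x, y} \<in> edges"
    then show "{turn x, turn y} \<in> edges" by (rule turn_edges)
  next
    fix q r q' r' and a b c d :: real
    assume "{Inr q, Inr r} \<in> edges" "{Inr q', Inr r'} \<in> edges" "0 < a" "0 < b" "0 < c" "0 < d"
      "a *\<^sub>R q + b *\<^sub>R r = c *\<^sub>R q' + d *\<^sub>R r'"
    then show "{q, r} = {q', r'}"
      using axis_disjoint[of q r q' r' a b c d] by (simp add: edges_iff vertices_iff)
  next
    fix q r s and a b c :: real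
    assume "{Inr q, Inr r} \<in> edges" "Inr s \<in> vertices" "0 < a" "0 < b" "0 < c"
    then show "a *\<^sub>R q + b *\<^sub>R r \<noteq> c *\<^sub>R s"
      using axis_vertex[of q r s a b c] by (simp add: edges_iff vertices_iff)
  next
    fix q r and a b :: real
    assume "{Inr q, Inr r} \<in> edges" "a *\<^sub>R q + b *\<^sub>R r = 0"
    then show "a = 0 \<and> b = 0"
      using axis_independent[of q r a b] by (simp add: edges_iff vertices_iff)
  next
    fix e assume "e \<in> edges"
    then obtain x y where "e = {x, y}" "x \<in> vertices" "y \<in> vertices" "colour x \<noteq> colour y"
      unfolding edges_def by blast
    moreover from this have "x \<noteq> y" by metis
    ultimately show "\<exists>x\<in>vertices. \<exists>y\<in>vertices. x \<noteq> y \<and> e = {x, y}"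
      by (intro bexI[of _ x] bexI[of _ y] conjI)
  next
    fix u :: complex assume "Inl u \<in> vertices"
    then show "cmod u = 1" by (rule unit_vertices)
  next
    fix q :: complex assume "Inr q \<in> vertices"
    then show "q \<noteq> 0" using axis_nonzero vertices_iff(2) by blast
  next
    fix q r :: complex and c :: real
    assume "Inr q \<in> vertices" "Inr r \<in> vertices" "0 < c" "q = c *\<^sub>R r"
    then show "q = r" using axis_rays[of q r c] unfolding vertices_iff(2) by blast
  next
    fix x assume "x \<in> vertices"
    then show "turn x \<in> vertices" using turn_vertices by blast
  qed
  have p_less: "p i < length ms" if "i < length ms'" for i
    using p that by (auto simp: bij_betw_def)
  \<comment> \<open>Any bijections between the parts and the colour classes of equal size form a
    graph isomorphism, since adjacency depends on the classes alone.\<close>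
  have "\<exists>h. bij_betw h {..<ms' ! i} {x \<in> vertices. colour x = p i}" if "i < length ms'" for i
    using finite_vertices card_colour_class[OF p_less[OF that]] ms'[OF that]
    by (intro finite_same_card_bij) auto
  then obtain h where h: "\<And>i. i < length ms' \<Longrightarrow> bij_betw (h i) {..<ms' ! i} {x \<in> vertices. colour x = p i}"
    by metis
  define F where "F = (\<lambda>(i, j). h i j)"
  have F: "F v \<in> vertices" "colour (F v) = p (fst v)" if "v \<in> cmp_vertices ms'" for v
  proof -
    obtain i j where v: "v = (i, j)" "i < length ms'" "j < ms' ! i"
      using \<open>v \<in> cmp_vertices ms'\<close> by (auto simp: cmp_vertices_def)
    then show "F v \<in> vertices" "colour (F v) = p (fst v)"
      using bij_betwE[OF h[OF v(2)]] by (simp_all add: F_def)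
  qed
  have same_part: "p (fst v) = p (fst w) \<longleftrightarrow> fst v = fst w" if "v \<in> cmp_vertices ms'" "w \<in> cmp_vertices ms'" for v w
    using that p by (auto simp: cmp_vertices_def bij_betw_def inj_on_eq_iff)
  have inj: "inj_on F (cmp_vertices ms')"
  proof (rule inj_onI)
    fix v w assume v: "v \<in> cmp_vertices ms'" and w: "w \<in> cmp_vertices ms'" and eq: "F v = F w"
    have "p (fst v) = p (fst w)" using F(2)[OF v] F(2)[OF w] eq by simp
    then have "fst v = fst w" using same_part v w by blast
    moreover obtain i j where ij: "v = (i, j)" "i < length ms'" "j < ms' ! i"
      using v by (auto simp: cmp_vertices_def)
    ultimately obtain j' where j': "w = (i, j')" "j' < ms' ! i"
      using w by (cases w) (auto simp: cmp_vertices_def)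
    have "h i j = h i j'" using eq ij j' by (simp add: F_def)
    then show "v = w"
      using bij_betw_imp_inj_on[OF h[OF ij(2)]] ij j' by (auto dest: inj_onD)
  qed
  have image: "F ` cmp_vertices ms' = vertices"
  proof (intro equalityI subsetI)
    fix x assume x: "x \<in> vertices"
    then have "colour x \<in> p ` {..<length ms'}"
      using colour_less p by (simp add: bij_betw_def)
    then obtain i where i: "i < length ms'" "colour x = p i" by blast
    have "x \<in> h i ` {..<ms' ! i}"
      using x i bij_betw_imp_surj_on[OF h[OF i(1)]] by simp
    then obtain j where "j < ms' ! i" "h i j = x" by auto
    with i show "x \<in> F ` cmp_vertices ms'"
      by (intro image_eqI[of _ _ "(i, j)"]) (auto simp: F_def cmp_vertices_def)
  qed (use F in auto)
  have "(`) F ` cmp_edges ms' = edges"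
  proof (intro equalityI subsetI)
    fix e assume "e \<in> (`) F ` cmp_edges ms'"
    then obtain v w where "e = {F v, F w}" "v \<in> cmp_vertices ms'" "w \<in> cmp_vertices ms'" "fst v \<noteq> fst w"
      by (auto simp: cmp_edges_def)
    then show "e \<in> edges" using F same_part by (auto simp: edges_iff)
  next
    fix e assume "e \<in> edges"
    then obtain x y where xy: "e = {x, y}" "x \<in> vertices" "y \<in> vertices" "colour x \<noteq> colour y"
      unfolding edges_def by blast
    then obtain v w where vw: "v \<in> cmp_vertices ms'" "w \<in> cmp_vertices ms'" "x = F v" "y = F w"
      using image by blast
    with xy F have "fst v \<noteq> fst w" by metis
    with vw have "{v, w} \<in> cmp_edges ms'" unfolding cmp_edges_def by blast
    moreover have "e = F ` {v, w}" using xy vw by simp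
    ultimately show "e \<in> (`) F ` cmp_edges ms'" by blast
  qed
  then show ?thesis
    by (rule G.achirally_embeddable[OF inj image]) (auto simp: cmp_edges_def)
qed

end

text \<open>The colour classes of a new block carry no axis vertices, since the axis colours refer to the
  old classes, whose indices do not change.\<close>

lemma symmetric_parts_append:
  assumes "symmetric_parts ms \<tau> f D c"
    and \<tau>': "\<And>j. j < length ms' \<Longrightarrow> \<tau>' j < length ms' \<and> \<tau>' (\<tau>' (\<tau>' (\<tau>' j))) = j"
    and sizes': "\<And>j. j < length ms' \<Longrightarrow> ms' ! j = f' j + f' (\<tau>' j) + f' (\<tau>' (\<tau>' j)) + f' (\<tau>' (\<tau>' (\<tau>' j)))"
    and side': "(\<forall>p\<in>D. Re p > 0) \<or> (\<forall>s<length ms'. f' s > 0 \<longrightarrow> \<tau>' (\<tau>' s) = s)"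
  shows "\<exists>\<tau> f. symmetric_parts (ms @ ms') \<tau> f D c"
proof -
  interpret symmetric_parts ms \<tau> f D c by fact
  let ?n = "length ms"
  define \<tau>2 where "\<tau>2 j = (if j < ?n then \<tau> j else ?n + \<tau>' (j - ?n))" for j
  define f2 where "f2 j = (if j < ?n then f j else f' (j - ?n))" for j
  have old: "\<tau>2 j = \<tau> j" "f2 j = f j" if "j < ?n" for j
    using that by (simp_all add: \<tau>2_def f2_def)
  have new: "\<tau>2 (?n + j) = ?n + \<tau>' j" "f2 (?n + j) = f' j" for j
    by (simp_all add: \<tau>2_def f2_def)
  have split: "j < ?n \<or> (\<exists>i<length ms'. j = ?n + i)" if "j < length (ms @ ms')" for j
    using that by (metis add_diff_inverse_nat length_append nat_add_left_cancel_less)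
  have "symmetric_parts (ms @ ms') \<tau>2 f2 D c"
  proof (unfold_locales, goal_cases)
    \<comment> \<open>Goal 3 is \<open>sizes\<close>, 6 is \<open>axis_colour_less\<close>, 8 is the
      colour half of \<open>axis_cnj\<close> and 13 is \<open>axis_side\<close>. The same numbering
      recurs for the axis configurations, with 4 for \<open>finite_axis\<close>, 9 for
      \<open>axis_rays\<close> and 12 for \<open>axis_disjoint\<close>.\<close>
    case (1 j)
    then show ?case using split[of j] \<tau>' by (auto simp: old new trans_less_add1[OF tau_less])
  next
    case (2 j)
    then show ?case using split[of j] \<tau>' by (auto simp: old new tau_less tau_4)
  next
    case (3 j)
    from split[OF 3] show ?case
    proof
      assume j: "j < ?n"
      then show ?thesis
        using sizes[OF j] by (simp add: old tau_less nth_append)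
    next
      assume "\<exists>i<length ms'. j = ?n + i"
      then obtain i where i: "i < length ms'" "j = ?n + i" by blast
      have "{p \<in> D. c p = j} = {}"
        using axis_colour_less i(2) by force
      then have "card {p \<in> D. c p = j} = 0" by (simp only: card.empty)
      then show ?thesis
        using sizes'[OF i(1)] by (simp add: i(2) new nth_append)
    qed
  next
    case (6 p)
    then show ?case using axis_colour_less by fastforce
  next
    case (8 p)
    then show ?case using axis_cnj axis_colour_less by (simp add: old)
  next
    case 13
    show ?case
    proof (cases "\<forall>p\<in>D. Re p > 0")
      case False
      have "\<tau>2 (\<tau>2 s) = s" if "s < length (ms @ ms')" "f2 s > 0" for s
        using split[OF that(1)] that(2) axis_side side' False by (auto simp: old new tau_less)
      then show ?thesis by blast
    qed simp
  qed (rule finite_axis axis_nonzero axis_cnj axis_rays axis_independent axis_vertex axis_disjoint; assumption)+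
  then show ?thesis by blast
qed

section \<open>Adding the blocks of the join while the axis stays fixed\<close>

definition symmetrizable :: "nat list \<Rightarrow> complex set \<Rightarrow> (complex \<Rightarrow> nat) \<Rightarrow> bool" where
  "symmetrizable ms D c \<longleftrightarrow> (\<exists>\<tau> f. symmetric_parts ms \<tau> f D c)"

text \<open>The parts are permuted cyclically and each of \<open>m\<close> orbits has one point in
  every part. Opposite points then have different colours and are joined by diameters, which forces
  the axis vertices to the right unless \<open>m = 0\<close>.\<close>

lemma symmetrizable_append_4:
  assumes "symmetrizable ms D c" "(\<forall>p\<in>D. Re p > 0) \<or> m = 0"
  shows "symmetrizable (ms @ [m, m, m, m]) D c"
proof -
  obtain \<tau> f where sp: "symmetric_parts ms \<tau> f D c"
    using assms(1) by (auto simp: symmetrizable_def)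
  show ?thesis
    unfolding symmetrizable_def
  proof (rule symmetric_parts_append[OF sp, where \<tau>' = "\<lambda>j. (j + 1) mod 4" and f' = "\<lambda>j. if j = 0 then m else 0"])
    fix j assume "j < length [m, m, m, m]"
    then have j: "j = 0 \<or> j = 1 \<or> j = 2 \<or> j = 3"
      using less_4_cases[of j] by simp
    then show "(j + 1) mod 4 < length [m, m, m, m] \<and> ((((j + 1) mod 4 + 1) mod 4 + 1) mod 4 + 1) mod 4 = j"
      by (elim disjE) simp_all
    from j show "[m, m, m, m] ! j = (if j = 0 then m else 0) + (if (j + 1) mod 4 = 0 then m else 0)
        + (if ((j + 1) mod 4 + 1) mod 4 = 0 then m else 0)
        + (if (((j + 1) mod 4 + 1) mod 4 + 1) mod 4 = 0 then m else 0)"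
      by (elim disjE) simp_all
  qed (use assms(2) in auto)
qed

text \<open>The two parts are swapped, and each orbit alternates between them, giving two points to
  each. Opposite points share a colour, so no diameter arises.\<close>

lemma symmetrizable_append_2:
  assumes "symmetrizable ms D c" "even m"
  shows "symmetrizable (ms @ [m, m]) D c"
proof -
  obtain \<tau> f where sp: "symmetric_parts ms \<tau> f D c"
    using assms(1) by (auto simp: symmetrizable_def)
  show ?thesis
    unfolding symmetrizable_def
  proof (rule symmetric_parts_append[OF sp, where \<tau>' = "\<lambda>j. 1 - j" and f' = "\<lambda>j. if j = 0 then m div 2 else 0"])
    fix j assume "j < length [m, m]"
    then have j: "j = 0 \<or> j = 1" by auto
    then show "1 - j < length [m, m] \<and> 1 - (1 - (1 - (1 - j))) = j"
      by (elim disjE) simp_all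
    from j show "[m, m] ! j = (if j = 0 then m div 2 else 0) + (if 1 - j = 0 then m div 2 else 0)
        + (if 1 - (1 - j) = 0 then m div 2 else 0) + (if 1 - (1 - (1 - j)) = 0 then m div 2 else 0)"
      using assms(2) by (elim disjE) auto
  qed auto
qed

text \<open>The part is invariant and consists of whole orbits.\<close>

lemma symmetrizable_append_1:
  assumes "symmetrizable ms D c" "4 dvd m"
  shows "symmetrizable (ms @ [m]) D c"
proof -
  obtain \<tau> f where sp: "symmetric_parts ms \<tau> f D c"
    using assms(1) by (auto simp: symmetrizable_def)
  show ?thesis
    unfolding symmetrizable_def
    by (rule symmetric_parts_append[OF sp, where \<tau>' = "\<lambda>j. j" and f' = "\<lambda>j. m div 4"])
      (use assms(2) in auto)
qed

text \<open>A size listed in \<open>g\<close> occurs once in each copy, so all its copies are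
  appended as one block. Only multisets are tracked because the order of the parts does not
  matter.\<close>

lemma symmetrizable_join:
  assumes "symmetrizable ms D c"
    and g1: "(\<forall>p\<in>D. Re p > 0) \<or> sum_list g1 = 0"
    and g2: "\<forall>m\<in>set g2. even m" and g3: "\<forall>m\<in>set g3. 4 dvd m"
  shows "\<exists>ns. symmetrizable ns D c \<and> mset ns = mset (join_copies 4 g1 @ join_copies 2 g2 @ g3 @ ms)"
proof -
  have join: "mset (join_copies n g) = repeat_mset n (mset g)" for n g
    by (induction n) (simp_all add: join_copies_def)
  have 4: "\<exists>ns. symmetrizable ns D c \<and> mset ns = repeat_mset 4 (mset g) + mset ms"
    if "(\<forall>p\<in>D. Re p > 0) \<or> sum_list g = 0" for g
    using that
  proof (induction g)
    case Nil
    then show ?case using assms(1) by auto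
  next
    case (Cons m g)
    then obtain ns where "symmetrizable ns D c" "mset ns = repeat_mset 4 (mset g) + mset ms" by auto
    with Cons.prems show ?case
      by (intro exI[of _ "ns @ [m, m, m, m]"]) (auto intro: symmetrizable_append_4 simp: eval_nat_numeral)
  qed
  have 2: "\<exists>ns. symmetrizable ns D c \<and> mset ns = repeat_mset 2 (mset g) + mset ms"
    if "symmetrizable ms D c" "\<forall>m\<in>set g. even m" for g ms
    using that(2)
  proof (induction g)
    case Nil
    then show ?case using that by auto
  next
    case (Cons m g)
    then obtain ns where "symmetrizable ns D c" "mset ns = repeat_mset 2 (mset g) + mset ms" by auto
    with Cons.prems show ?case
      by (intro exI[of _ "ns @ [m, m]"]) (auto intro: symmetrizable_append_2 simp: eval_nat_numeral)
  qed
  have 1: "\<exists>ns. symmetrizable ns D c \<and> mset ns = mset g + mset ms"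
    if "symmetrizable ms D c" "\<forall>m\<in>set g. 4 dvd m" for g ms
    using that(2)
  proof (induction g)
    case Nil
    then show ?case using that by auto
  next
    case (Cons m g)
    then obtain ns where "symmetrizable ns D c" "mset ns = mset g + mset ms" by auto
    with Cons.prems show ?case
      by (intro exI[of _ "ns @ [m]"]) (auto intro: symmetrizable_append_1)
  qed
  obtain n1 where n1: "symmetrizable n1 D c" "mset n1 = repeat_mset 4 (mset g1) + mset ms"
    using 4[OF g1] by blast
  obtain n2 where n2: "symmetrizable n2 D c" "mset n2 = repeat_mset 2 (mset g2) + mset n1"
    using 2[OF n1(1) g2] by blast
  obtain n3 where n3: "symmetrizable n3 D c" "mset n3 = mset g3 + mset n2"
    using 1[OF n2(1) g3] by blast
  have "mset n3 = mset (join_copies 4 g1 @ join_copies 2 g2 @ g3 @ ms)"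
    by (simp add: n1(2) n2(2) n3(2) join)
  with n3(1) show ?thesis by blast
qed

lemma symmetrizable_imp_achirally_embeddable:
  assumes "symmetrizable ns D c" "mset ns = mset ms"
  shows "achirally_embeddable (cmp_vertices ms) (cmp_edges ms)"
proof -
  obtain \<tau> f where "symmetric_parts ns \<tau> f D c"
    using assms(1) by (auto simp: symmetrizable_def)
  moreover obtain p where "bij_betw p {..<length ms} {..<length ns}" "\<forall>i<length ms. ms ! i = ns ! p i"
    using permutation_Ex_bij[of ms ns] assms(2) by auto
  ultimately show ?thesis
    using symmetric_parts.achirally_embeddable_cmp by metis
qed

section \<open>Axis configurations for the three exceptional parts\<close>

lemma filter_insert:
  "{x \<in> insert a A. P x} = (if P a then insert a {x \<in> A. P x} else {x \<in> A. P x})"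
  by auto

lemma less_3_cases: "j < length [a, b, c] \<Longrightarrow> j = 0 \<or> j = 1 \<or> j = 2"
  by auto

text \<open>The residue of \<open>n\<close> modulo 4 is realised on the axis by a real direction, a
  conjugate pair or both. They share a colour, so the axis carries no edge.\<close>

lemma symmetrizable_one_part:
  "\<exists>D c. symmetrizable [0, 0, n] D c \<and> (\<forall>p\<in>D. Re p > 0)"
proof -
  define D where "D = (if n mod 4 = 0 then {} else if n mod 4 = 1 then {Complex 1 0}
    else if n mod 4 = 2 then {Complex 1 1, Complex 1 (- 1)} else {Complex 1 0, Complex 1 1, Complex 1 (- 1)})"
  have D: "D \<subseteq> {Complex 1 0, Complex 1 1, Complex 1 (- 1)}" "cnj ` D \<subseteq> D"
    by (auto simp: D_def complex_eq_iff)
  have "n mod 4 < 4" by simp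
  then have card: "card D = n mod 4"
    by (auto dest!: less_4_cases simp: D_def)
  have "symmetric_parts [0, 0, n] (\<lambda>j. j) (\<lambda>j. if j = 2 then n div 4 else 0) D (\<lambda>_. 2)"
  proof (unfold_locales, goal_cases)
    case (3 j)
    have "n = 4 * (n div 4) + card D" by (simp add: card)
    with less_3_cases[OF 3] show ?case by (elim disjE) simp_all
  next
    case 4
    show ?case using D(1) by (rule finite_subset) simp
  next
    case (9 p q c)
    then have "p \<in> {Complex 1 0, Complex 1 1, Complex 1 (- 1)}" "q \<in> {Complex 1 0, Complex 1 1, Complex 1 (- 1)}"
      using D(1) by auto
    with 9 show ?case by (auto simp: complex_eq_iff)
  qed (use D in \<open>auto simp: complex_eq_iff\<close>)
  moreover have "\<forall>p\<in>D. Re p > 0" using D by auto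
  ultimately show ?thesis by (auto simp: symmetrizable_def)
qed

text \<open>One vertex of each part goes to the axis, and these two are conjugate; the other
  \<open>n - 1\<close> of each part come from orbits alternating between the parts. The single axis
  edge crosses the direction 1.\<close>

lemma symmetrizable_swapped_parts:
  assumes "odd n"
  shows "\<exists>D c. symmetrizable [n, n, 0] D c \<and> (\<forall>p\<in>D. Re p > 0)"
proof -
  let ?D = "{Complex 1 1, Complex 1 (- 1)}"
  let ?c = "\<lambda>p. if Im p > 0 then 0 else 1 :: nat"
  have n: "n = 2 * (n div 2) + 1" using assms by presburger+
  have "symmetric_parts [n, n, 0] (\<lambda>j. if j = 0 then 1 else if j = 1 then 0 else j)
      (\<lambda>j. if j = 0 then n div 2 else 0) ?D ?c"
  proof (unfold_locales, goal_cases)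
    case (3 j)
    from less_3_cases[OF 3] n show ?case unfolding filter_insert by (elim disjE) simp_all
  next
    case (12 p q p' q' a b c d)
    from 12 show ?case
      by (elim insertE emptyE; hypsubst; simp (no_asm_use) add: complex_eq_iff insert_commute; linarith)
  qed (auto simp: complex_eq_iff)
  then have "symmetrizable [n, n, 0] ?D ?c"
    by (auto simp: symmetrizable_def)
  moreover have "\<forall>p\<in>?D. Re p > 0" by simp
  ultimately show ?thesis by blast
qed

text \<open>The directions -1 + i and -1 - i represent the two swapped parts and 1 the invariant
  one. The three axis edges fill the whole axis, so no arc is left for diameters.\<close>

lemma symmetrizable_triangle:
  assumes "odd n" "k mod 4 = 1"
  shows "\<exists>D c. symmetrizable [n, n, k] D c"
proof -
  let ?D = "{Complex (- 1) 1, Complex (- 1) (- 1), Complex 1 0}"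
  let ?c = "\<lambda>p. if Im p > 0 then 0 else if Im p < 0 then 1 else 2 :: nat"
  \<comment> \<open>\<open>?e z\<close> is the edge whose open cone contains \<open>z\<close>. As it
    depends on \<open>z\<close> alone, a point common to two cones forces equal edges.\<close>
  let ?e = "\<lambda>z. if Im z > 0 \<and> Re z + Im z > 0 then {Complex (- 1) 1, Complex 1 0}
    else if Im z < 0 \<and> Re z - Im z > 0 then {Complex (- 1) (- 1), Complex 1 0}
    else {Complex (- 1) 1, Complex (- 1) (- 1)}"
  have cone: "{p, q} = ?e (a *\<^sub>R p + b *\<^sub>R q)"
    if "p \<in> ?D" "q \<in> ?D" "?c p \<noteq> ?c q" "a > 0" "b > 0" for p q and a b :: real
    using that by auto
  have n: "n = 2 * (n div 2) + 1" "k = 4 * (k div 4) + 1" using assms by presburger+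
  have "symmetric_parts [n, n, k] (\<lambda>j. if j = 0 then 1 else if j = 1 then 0 else j)
      (\<lambda>j. if j = 0 then n div 2 else if j = 2 then k div 4 else 0) ?D ?c"
  proof (unfold_locales, goal_cases)
    case (3 j)
    from less_3_cases[OF 3] n show ?case unfolding filter_insert by (elim disjE) simp_all
  next
    case (12 p q p' q' a b c d)
    have "{p, q} = ?e (a *\<^sub>R p + b *\<^sub>R q)" "{p', q'} = ?e (c *\<^sub>R p' + d *\<^sub>R q')"
      by (rule cone[OF 12(1-3,7,8)], rule cone[OF 12(4-6,9,10)])
    with 12(11) show ?case by simp
  qed (auto simp: complex_eq_iff)
  then have "symmetrizable [n, n, k] ?D ?c"
    by (auto simp: symmetrizable_def)
  then show ?thesis by blast
qed

text \<open>Both parts are invariant. The axis edges form the path from 1 + i through 1 to 1 - i,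
  inside the right half plane.\<close>

lemma symmetrizable_path:
  assumes "n mod 4 = 2" "k mod 4 = 1"
  shows "\<exists>D c. symmetrizable [n, k, 0] D c \<and> (\<forall>p\<in>D. Re p > 0)"
proof -
  let ?D = "{Complex 1 1, Complex 1 (- 1), Complex 1 0}"
  let ?c = "\<lambda>p. if Im p = 0 then 1 else 0 :: nat"
  let ?e = "\<lambda>z. {Complex 1 (sgn (Im z)), Complex 1 0}"
  have cone: "{p, q} = ?e (a *\<^sub>R p + b *\<^sub>R q)"
    if "p \<in> ?D" "q \<in> ?D" "?c p \<noteq> ?c q" "a > 0" "b > 0" for p q and a b :: real
    using that by auto
  have n: "n = 4 * (n div 4) + 2" "k = 4 * (k div 4) + 1" using assms by presburger+
  have "symmetric_parts [n, k, 0] (\<lambda>j. j)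
      (\<lambda>j. if j = 0 then n div 4 else if j = 1 then k div 4 else 0) ?D ?c"
  proof (unfold_locales, goal_cases)
    case (3 j)
    from less_3_cases[OF 3] n show ?case unfolding filter_insert by (elim disjE) simp_all
  next
    case (12 p q p' q' a b c d)
    have "{p, q} = ?e (a *\<^sub>R p + b *\<^sub>R q)" "{p', q'} = ?e (c *\<^sub>R p' + d *\<^sub>R q')"
      by (rule cone[OF 12(1-3,7,8)], rule cone[OF 12(4-6,9,10)])
    with 12(11) show ?case by simp
  qed (auto simp: complex_eq_iff)
  then have "symmetrizable [n, k, 0] ?D ?c"
    by (auto simp: symmetrizable_def)
  moreover have "\<forall>p\<in>?D. Re p > 0" by simp
  ultimately show ?thesis by blast
qed

text \<open>Conjugation swaps i and -i, taken from one part, and fixes 1 and -1, taken from the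
  other. The four axis edges again fill the axis.\<close>

lemma symmetrizable_square:
  assumes "n mod 4 = 2" "k mod 4 = 2"
  shows "\<exists>D c. symmetrizable [n, k, 0] D c"
proof -
  let ?D = "{Complex 0 1, Complex 0 (- 1), Complex 1 0, Complex (- 1) 0}"
  let ?c = "\<lambda>p. if Im p = 0 then 1 else 0 :: nat"
  let ?e = "\<lambda>z. {Complex (sgn (Re z)) 0, Complex 0 (sgn (Im z))}"
  have cone: "{p, q} = ?e (a *\<^sub>R p + b *\<^sub>R q)"
    if "p \<in> ?D" "q \<in> ?D" "?c p \<noteq> ?c q" "a > 0" "b > 0" for p q and a b :: real
    using that by auto
  have n: "n = 4 * (n div 4) + 2" "k = 4 * (k div 4) + 2" using assms by presburger+
  have "symmetric_parts [n, k, 0] (\<lambda>j. j)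
      (\<lambda>j. if j = 0 then n div 4 else if j = 1 then k div 4 else 0) ?D ?c"
  proof (unfold_locales, goal_cases)
    case (3 j)
    from less_3_cases[OF 3] n show ?case unfolding filter_insert by (elim disjE) simp_all
  next
    case (12 p q p' q' a b c d)
    have "{p, q} = ?e (a *\<^sub>R p + b *\<^sub>R q)" "{p', q'} = ?e (c *\<^sub>R p' + d *\<^sub>R q')"
      by (rule cone[OF 12(1-3,7,8)], rule cone[OF 12(4-6,9,10)])
    with 12(11) show ?case by simp
  qed (auto simp: complex_eq_iff)
  then have "symmetrizable [n, k, 0] ?D ?c"
    by (auto simp: symmetrizable_def)
  then show ?thesis by blast
qed

theorem theorem1:
  fixes g1 g2 g3 :: "nat list" and q1 q2 q3 :: nat
  assumes g2_even: "\<forall>m\<in>set g2. even m"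
    and g3_div4: "\<forall>m\<in>set g3. 4 dvd m"
    and cond: "\<exists>a b c. mset [a, b, c] = mset [q1, q2, q3] \<and>
       ((a = 0 \<and> b = 0)
      \<or> (odd a \<and> a = b \<and> c = 0)
      \<or> (odd a \<and> a = b \<and> c mod 4 = 1 \<and> sum_list g1 = 0)
      \<or> (a mod 4 = 2 \<and> b mod 4 = 1 \<and> c = 0)
      \<or> (a mod 4 = 2 \<and> b mod 4 = 2 \<and> c = 0 \<and> sum_list g1 = 0))"
  shows "achirally_embeddable
           (cmp_vertices (join_copies 4 g1 @ join_copies 2 g2 @ g3 @ [q1, q2, q3]))
           (cmp_edges (join_copies 4 g1 @ join_copies 2 g2 @ g3 @ [q1, q2, q3]))"
proof -
  obtain a b c where abc: "mset [a, b, c] = mset [q1, q2, q3]"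
    and cases: "(a = 0 \<and> b = 0)
      \<or> (odd a \<and> a = b \<and> c = 0)
      \<or> (odd a \<and> a = b \<and> c mod 4 = 1 \<and> sum_list g1 = 0)
      \<or> (a mod 4 = 2 \<and> b mod 4 = 1 \<and> c = 0)
      \<or> (a mod 4 = 2 \<and> b mod 4 = 2 \<and> c = 0 \<and> sum_list g1 = 0)"
    using cond by blast
  \<comment> \<open>Each disjunct has its own configuration. The triangle and the square, which
    leave no arc of the axis free, are used where \<open>sum_list g1 = 0\<close>, that is, where the
    first graph has no vertices.\<close>
  have "\<exists>D k. symmetrizable [a, b, c] D k \<and> ((\<forall>p\<in>D. Re p > 0) \<or> sum_list g1 = 0)"
    using cases symmetrizable_one_part[of c] symmetrizable_swapped_parts[of a]
      symmetrizable_triangle[of a c] symmetrizable_path[of a b] symmetrizable_square[of a b]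
    by (elim disjE conjE) blast+
  then obtain D k where "symmetrizable [a, b, c] D k" "(\<forall>p\<in>D. Re p > 0) \<or> sum_list g1 = 0"
    by blast
  then obtain ns where "symmetrizable ns D k"
    and "mset ns = mset (join_copies 4 g1 @ join_copies 2 g2 @ g3 @ [a, b, c])"
    using symmetrizable_join g2_even g3_div4 by blast
  moreover from this(2) have "mset ns = mset (join_copies 4 g1 @ join_copies 2 g2 @ g3 @ [q1, q2, q3])"
    by (simp only: mset_append abc)
  ultimately show ?thesis
    by (intro symmetrizable_imp_achirally_embeddable)
qed

end
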